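(* Let $a$, $b$, and $c$ be indeterminates. The infinite matrices $(f_{nk})_{n,k\in\mathbb Z}$ and $(g_{kl})_{k,l\in\mathbb Z}$ are inverses of each other, where $$f_{nk}=\frac{(aq/b,bq/a,aq/c,cq/a,bq,q/b,cq,q/c;q)_{\infty}}{(q,q,aq,q/a,aq/bc,bcq/a,cq/b,bq/c;q)_{\infty}}\cdot\frac{(1-bcq^{2n}/a)}{(1-bc/a)}\cdot\frac{(b;q)_{n+k}\,(a/c;q)_{k-n}}{(cq;q)_{n+k}\,(aq/b;q)_{k-n}}$$ and $$g_{kl}=\frac{(1-aq^{2k})}{(1-a)}\cdot\frac{(c;q)_{k+l}\,(a/b;q)_{k-l}}{(bq;q)_{k+l}\,(aq/c;q)_{k-l}}\,q^{k-l}.$$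
   Context: Here $q$ is a fixed complex number with $0<|q|<1$. Notation: $(x;q)_\infty=\prod_{j\ge 0}(1-xq^j)$; for every integer $k$, $(x;q)_k=(x;q)_\infty/(xq^k;q)_\infty$, i.e. $(x;q)_k=\prod_{j=0}^{k-1}(1-xq^j)$ for $k\ge0$ and $(x;q)_{k}=\prod_{j=1}^{-k}(1-xq^{-j})^{-1}$ for $k<0$; and $(x_1,\dots,x_m;q)_k=(x_1;q)_k\cdots(x_m;q)_k$ for $k$ an integer or $\infty$. In a parameter such as $aq/bc$ everything after the slash is in the denominator, i.e. $aq/bc=aq/(bc)$. The indeterminates are understood as nonzero complex numbers in general position (no denominator occurring in the statement vanishes). Infinite matrices $(f_{nk})_{n,k\in\mathbb Z}$ and $(g_{kl})_{k,l\in\mathbb Z}$ (not required to be lower-triangular) are called inverses of each other if and only if the orthogonality relation $\sum_{k\in\mathbb Z}f_{nk}g_{kl}=\delta_{nl}$ holds for all $n,l\in\mathbb Z$, where the infinite sums are required to converge absolutely and $\delta_{nl}$ is the Kronecker delta. *)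

theory Defs
  imports "HOL-Analysis.Analysis"
begin

definition qpoch_inf :: "complex \<Rightarrow> complex \<Rightarrow> complex" where
  "qpoch_inf x q = (\<Prod>j. 1 - x * q ^ j)"

definition qpoch_infs :: "complex list \<Rightarrow> complex \<Rightarrow> complex" where
  "qpoch_infs xs q = (\<Prod>x\<leftarrow>xs. qpoch_inf x q)"

(* Only meaningful if x * q powi k is not of the form q powi (-j) with j a natural number;
   otherwise the denominator is 0 and HOL returns 0. *)
definition qpoch :: "complex \<Rightarrow> complex \<Rightarrow> int \<Rightarrow> complex" where
  "qpoch x q k = qpoch_inf x q / qpoch_inf (x * q powi k) q"

definition f_matrix ::
  "complex \<Rightarrow> complex \<Rightarrow> complex \<Rightarrow> complex \<Rightarrow> int \<Rightarrow> int \<Rightarrow> complex" where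
  "f_matrix q a b c n k =
     qpoch_infs [a * q / b, b * q / a, a * q / c, c * q / a, b * q, q / b, c * q, q / c] q
     / qpoch_infs [q, q, a * q, q / a, a * q / (b * c), b * c * q / a, c * q / b, b * q / c] q
     * ((1 - b * c * q powi (2 * n) / a) / (1 - b * c / a))
     * ((qpoch b q (n + k) * qpoch (a / c) q (k - n))
        / (qpoch (c * q) q (n + k) * qpoch (a * q / b) q (k - n)))"

definition g_matrix ::
  "complex \<Rightarrow> complex \<Rightarrow> complex \<Rightarrow> complex \<Rightarrow> int \<Rightarrow> int \<Rightarrow> complex" where
  "g_matrix q a b c k l =
     (1 - a * q powi (2 * k)) / (1 - a)
     * ((qpoch c q (k + l) * qpoch (a / b) q (k - l))
        / (qpoch (b * q) q (k + l) * qpoch (a * q / c) q (k - l)))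
     * q powi (k - l)"

(* The summability of the norms has to be demanded separately: infsum is 0 for families
   that are not summable. *)
definition inverse_matrices :: "(int \<Rightarrow> int \<Rightarrow> complex) \<Rightarrow> (int \<Rightarrow> int \<Rightarrow> complex) \<Rightarrow> bool" where
  "inverse_matrices f g \<longleftrightarrow>
     (\<forall>n l. (\<lambda>k. norm (f n k * g k l)) summable_on UNIV \<and>
            (\<Sum>\<^sub>\<infinity>k. f n k * g k l) = (if n = l then 1 else 0))"

lemma convergent_prod_qpoch:
  fixes x q :: complex
  assumes "norm q < 1"
  shows "convergent_prod (\<lambda>j. 1 - x * q ^ j)"
proof -
  have "summable (\<lambda>j. norm x * norm q ^ j)"
    using assms by (intro summable_mult summable_geometric) simp
  then have "summable (\<lambda>j. norm ((1 - x * q ^ j) - 1))"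
    by (simp add: norm_mult norm_power)
  then show ?thesis
    using abs_convergent_prod_conv_summable abs_convergent_prod_imp_convergent_prod by blast
qed

lemma qpoch_inf_split:
  assumes "norm q < 1"
  shows "qpoch_inf x q = (\<Prod>j<n. 1 - x * q ^ j) * qpoch_inf (x * q ^ n) q"
  using has_prod_unique[OF has_prod_ignore_initial_segment'[OF convergent_prod_qpoch[OF assms], of x n]]
  unfolding qpoch_inf_def by (simp add: power_add mult_ac)

lemma qpoch_inf_nonzero:
  assumes "norm q < 1" "\<And>j. x * q ^ j \<noteq> 1"
  shows "qpoch_inf x q \<noteq> 0"
  unfolding qpoch_inf_def
  using assms(2) by (intro prodinf_nonzero convergent_prod_qpoch[OF assms(1)]) (metis eq_iff_diff_eq_0)

lemma qpoch_of_nat: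
  assumes "norm q < 1" "\<And>j. x * q ^ (n + j) \<noteq> 1"
  shows "qpoch x q (int n) = (\<Prod>j<n. 1 - x * q ^ j)"
proof -
  have "qpoch_inf (x * q ^ n) q \<noteq> 0"
    using assms(2) by (intro qpoch_inf_nonzero[OF assms(1)]) (simp add: power_add mult.assoc)
  then show ?thesis
    using qpoch_inf_split[OF assms(1), of x n] by (simp add: qpoch_def)
qed

lemma qpoch_minus_of_nat:
  assumes "q \<noteq> 0" "norm q < 1" "\<And>j. x * q powi (int j - int n) \<noteq> 1"
  shows "qpoch x q (- int n) = (\<Prod>j=1..n. inverse (1 - x * q powi (- int j)))"
proof -
  define y where "y = x * q powi (- int n)"
  have y: "y * q ^ j = x * q powi (int j - int n)" for j
    using assms(1) by (simp add: y_def power_int_diff power_int_minus field_simps)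
  have nz: "qpoch_inf y q \<noteq> 0"
    by (rule qpoch_inf_nonzero[OF assms(2)]) (simp only: y assms(3) not_False_eq_True)
  have "qpoch_inf y q = (\<Prod>j<n. 1 - y * q ^ j) * qpoch_inf x q"
    using qpoch_inf_split[OF assms(2), of y n] y[of n] by simp
  with nz have "qpoch x q (- int n) = inverse (\<Prod>j<n. 1 - y * q ^ j)"
    by (auto simp: qpoch_def y_def field_simps)
  also have "(\<Prod>j<n. 1 - y * q ^ j) = (\<Prod>j=1..n. 1 - x * q powi (- int j))"
    by (rule prod.reindex_bij_witness[of _ "\<lambda>j. n - j" "\<lambda>j. n - j"])
       (auto simp: y)
  finally show ?thesis
    using prod_inversef[of "\<lambda>j. 1 - x * q powi (- int j)" "{1..n}"] by (simp add: o_def)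
qed

end

theory Submission
  imports Defs
begin

text \<open>
  The product \<open>f\<^sub>n\<^sub>k g\<^sub>k\<^sub>l\<close> is, up to a factor that does not depend on \<open>k\<close>, the term
  \[ \tau_k = q^k (1 - A q^{2k}) \prod_{i=1}^4 \frac{(A q^{k+1}/x_i)_\infty}{(x_i q^k)_\infty} \]
  of a bilateral very-well-poised series, with \<open>A = a\<close> and parameters \<open>b q\<^sup>n\<close>, \<open>a q\<^sup>-\<^sup>n / c\<close>,
  \<open>c q\<^sup>l\<close>, \<open>a q\<^sup>-\<^sup>l / b\<close>, whose product is \<open>A\<^sup>2\<close>.  Bailey's sum of a very-well-poised
  bilateral series therefore gives the orthogonality, but the balancing condition
  \<open>x\<^sub>1 x\<^sub>2 x\<^sub>3 x\<^sub>4 = A\<^sup>2\<close> makes this special case elementary: the series telescopes.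

  Indeed \<open>C \<tau>\<^sub>k = V\<^sub>k - V\<^sub>k\<^sub>-\<^sub>1\<close>, where \<open>V\<^sub>k\<close> is a quotient of q-Pochhammer symbols and
  \<open>C\<close> is a multiple of \<open>(1 - x\<^sub>1x\<^sub>2/A) (1 - x\<^sub>1x\<^sub>3/A) (1 - x\<^sub>1x\<^sub>4/A)\<close> (\<open>antidifference_step\<close>).  Since \<open>V\<^sub>k\<close>
  tends to \<open>1\<close> at \<open>\<infinity>\<close> and to \<open>\<Prod> \<theta>(A/x\<^sub>i) / \<theta>(x\<^sub>i)\<close> at \<open>-\<infinity>\<close>, the sum times \<open>C\<close> is a difference of two
  theta products.  The addition formula of Weierstrass (\<open>theta_addition\<close>) turns this difference into
  one product that contains the same three factors, so that \<open>C\<close> cancels.  If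
  \<open>C = 0\<close> -- which happens on the diagonal \<open>n = l\<close>, the case that matters most -- the result follows
  by deforming two parameters and passing to the limit (\<open>vwp_sum\<close>).

  The addition formula is derived from series: by the Jacobi triple product
  (\<open>jacobi_triple_product\<close>), \<open>\<theta>\<close> is a constant multiple of a bilateral series with
  triangular exponents, and splitting the product of two such series according to the parity of the
  total degree (\<open>jseries_product\<close>) writes \<open>\<theta>(x) \<theta>(y)\<close> in terms of functions of \<open>x y\<close> and of \<open>x / y\<close>;
  the rest is a polynomial identity.

  In the evaluated sum, one factor is \<open>\<theta>(z) / (1 - z)\<close> at \<open>z = q\<^sup>n\<^sup>-\<^sup>l\<close>, which
  vanishes for \<open>n \<noteq> l\<close> and equals \<open>(q)\<^sub>\<infinity>\<^sup>2\<close> for \<open>n = l\<close>.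
\<close>

section \<open>Sums over the integers\<close>

lemma has_sum_int_split:
  fixes f :: "int \<Rightarrow> complex"
  assumes "summable (\<lambda>n. norm (f (int n)))" "summable (\<lambda>n. norm (f (- int n - 1)))"
  shows "(f has_sum (\<Sum>n. f (int n)) + (\<Sum>n. f (- int n - 1))) UNIV"
proof -
  have "((\<lambda>n. f (int n)) has_sum (\<Sum>n. f (int n))) UNIV"
    using norm_summable_imp_has_sum[OF assms(1)] summable_sums[OF summable_norm_cancel[OF assms(1)]] by blast
  then have 1: "(f has_sum (\<Sum>n. f (int n))) {0..}"
    by (subst has_sum_reindex_bij_witness[of "UNIV" nat int "{0..}" f, symmetric]) auto
  have "((\<lambda>n. f (- int n - 1)) has_sum (\<Sum>n. f (- int n - 1))) UNIV"
    using norm_summable_imp_has_sum[OF assms(2)] summable_sums[OF summable_norm_cancel[OF assms(2)]] by blast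
  then have 2: "(f has_sum (\<Sum>n. f (- int n - 1))) {..<0}"
    by (subst has_sum_reindex_bij_witness
          [of "UNIV" "\<lambda>k. nat (- k - 1)" "\<lambda>n. - int n - 1" "{..<0}" f, symmetric]) auto
  have "{0::int..} \<union> {..<0} = UNIV" "{0::int..} \<inter> {..<0} = {}" by auto
  with has_sum_Un_disjoint[OF 1 2] show ?thesis by simp
qed

lemma abs_summable_int_split:
  fixes f :: "int \<Rightarrow> complex"
  assumes "summable (\<lambda>n. norm (f (int n)))" "summable (\<lambda>n. norm (f (- int n - 1)))"
  shows "(\<lambda>k. norm (f k)) summable_on UNIV"
proof -
  have "((\<lambda>k. complex_of_real (norm (f k))) has_sum
      (\<Sum>n. complex_of_real (norm (f (int n)))) + (\<Sum>n. complex_of_real (norm (f (- int n - 1))))) UNIV"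
    by (rule has_sum_int_split) (use assms in auto)
  then have "(\<lambda>k. complex_of_real (norm (f k))) summable_on UNIV"
    by (auto simp: summable_on_def)
  from summable_on_Re[OF this] show ?thesis by simp
qed

text \<open>
  Both passages to the limit below (from the finite to the infinite triple product, and to
  coinciding parameters in the bilateral sum) take place under a sum over the integers; this is
  Tannery's theorem on each half line.
\<close>
lemma infsum_int_dominated:
  fixes a :: "int \<Rightarrow> nat \<Rightarrow> complex" and M :: "int \<Rightarrow> real"
  assumes lim: "\<And>k. (\<lambda>n. a k n) \<longlonglongrightarrow> b k"
    and bound: "\<And>k n. norm (a k n) \<le> M k"
    and M: "summable (\<lambda>n. M (int n))" "summable (\<lambda>n. M (- int n - 1))"
  shows "(\<lambda>n. \<Sum>\<^sub>\<infinity>k. a k n) \<longlonglongrightarrow> (\<Sum>\<^sub>\<infinity>k. b k)"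
proof -
  have bb: "norm (b k) \<le> M k" for k
    by (rule tendsto_upperbound[OF tendsto_norm[OF lim[of k]]]) (simp_all add: bound)
  have split: "(\<Sum>\<^sub>\<infinity>k. f k) = (\<Sum>n. f (int n)) + (\<Sum>n. f (- int n - 1))"
    if "\<And>k. norm (f k) \<le> M k" for f :: "int \<Rightarrow> complex"
  proof (rule infsumI[OF has_sum_int_split])
    show "summable (\<lambda>n. norm (f (int n)))"
      by (rule summable_comparison_test'[OF M(1), of 0]) (use that in auto)
    show "summable (\<lambda>n. norm (f (- int n - 1)))"
      by (rule summable_comparison_test'[OF M(2), of 0]) (use that in auto)
  qed
  have "(\<lambda>n. \<Sum>k. a (int k) n) \<longlonglongrightarrow> (\<Sum>k. b (int k))"
    by (rule tannerys_theorem[of _ _ _ "\<lambda>k. M (int k)", THEN conjunct2, THEN conjunct2])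
       (simp_all add: lim bound M(1) case_prod_unfold)
  moreover have "(\<lambda>n. \<Sum>k. a (- int k - 1) n) \<longlonglongrightarrow> (\<Sum>k. b (- int k - 1))"
    by (rule tannerys_theorem[of _ _ _ "\<lambda>k. M (- int k - 1)", THEN conjunct2, THEN conjunct2])
       (simp_all add: lim bound M(2) case_prod_unfold)
  ultimately show ?thesis
    using split[of b] split[of "\<lambda>k. a k _"] bound bb by (simp add: tendsto_add)
qed

lemma has_sum_product:
  fixes f :: "'a \<Rightarrow> complex" and g :: "'b \<Rightarrow> complex"
  assumes "(\<lambda>i. norm (f i)) summable_on A" "(\<lambda>j. norm (g j)) summable_on B"
    and f: "(f has_sum S) A" and g: "(g has_sum T) B"
  shows "((\<lambda>(i, j). f i * g j) has_sum S * T) (A \<times> B)"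
proof (rule has_sum_SigmaI)
  show "((\<lambda>j. case (i, j) of (i, j) \<Rightarrow> f i * g j) has_sum f i * T) B" for i
    using has_sum_cmult_right[OF g] by simp
  show "((\<lambda>i. f i * T) has_sum S * T) A"
    by (rule has_sum_cmult_left[OF f])
  have "(\<lambda>x. norm (case x of (i, j) \<Rightarrow> f i * g j)) summable_on A \<times> B"
    unfolding Infinite_Sum.abs_summable_on_Sigma_iff
    using assms(1,2) by (auto simp: norm_mult abs_mult infsum_cmult_right infsum_nonneg
        intro!: summable_on_cmult_right summable_on_cmult_left)
  then show "(\<lambda>(i, j). f i * g j) summable_on A \<times> B"
    by (rule Infinite_Sum.abs_summable_summable)
qed

section \<open>Products of the series with triangular exponents\<close>

text \<open>
  The theta series with base \<open>p\<close>, term by term: \<open>(- 1)\<^sup>k p\<^bsup>k(k-1)/2\<^esup> x\<^sup>k\<close>.  The base is a parameter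
  because the product formula below leads from base \<open>p\<close> to base \<open>p\<^sup>2\<close>.
\<close>
definition jterm :: "complex \<Rightarrow> complex \<Rightarrow> int \<Rightarrow> complex" where
  "jterm p x k = (- 1) powi k * p powi (k * (k - 1) div 2) * x powi k"

definition jseries :: "complex \<Rightarrow> complex \<Rightarrow> complex" where
  "jseries p x = (\<Sum>\<^sub>\<infinity>k. jterm p x k)"

lemma triangular_step: "(k + 1) * k div 2 = k * (k - 1) div 2 + (k :: int)"
proof -
  have "(k + 1) * k = k * (k - 1) + k * 2" by (simp add: algebra_simps)
  then show ?thesis by simp
qed

lemma jterm_step:
  assumes "p \<noteq> 0" "x \<noteq> 0"
  shows "jterm p x (k + 1) = - x * p powi k * jterm p x k"
  using assms by (simp add: jterm_def power_int_add triangular_step)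

text \<open>
  The quotient of consecutive terms is a multiple of \<open>p\<^sup>n\<close> in either direction, so
  the ratio test applies.
\<close>
lemma summable_jterm:
  assumes p: "p \<noteq> 0" "norm p < 1" and x: "x \<noteq> 0"
  shows "summable (\<lambda>n. norm (jterm p x (int n)))"
    and "summable (\<lambda>n. norm (jterm p x (- int n - 1)))"
proof -
  have lim: "(\<lambda>n. norm (C * p ^ n)) \<longlonglongrightarrow> 0" for C
    using tendsto_norm_zero[OF tendsto_mult_right_zero[OF LIMSEQ_power_zero[OF p(2)]]] .
  have ratio: "summable (\<lambda>n. norm (h n))"
    if h: "\<And>n. h (Suc n) = C * p ^ n * h n" for h :: "nat \<Rightarrow> complex" and C
  proof -
    have "eventually (\<lambda>n. norm (C * p ^ n) < 1 / 2) sequentially"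
      by (rule order_tendstoD(2)[OF lim]) simp
    then obtain N where "\<And>n. n \<ge> N \<Longrightarrow> norm (C * p ^ n) < 1 / 2"
      by (auto simp: eventually_at_top_linorder)
    then show ?thesis
      by (intro summable_ratio_test[of "1 / 2" N]) (simp_all add: h norm_mult[of _ "h _"] mult_right_mono less_imp_le del: times_divide_eq_left)
  qed
  show "summable (\<lambda>n. norm (jterm p x (int n)))"
  proof (rule ratio[where C = "- x"])
    show "jterm p x (int (Suc n)) = - x * p ^ n * jterm p x (int n)" for n
      using jterm_step[OF p(1) x, of "int n"] by (simp add: add.commute)
  qed
  have "jterm p x (- int (Suc n) - 1) = - (p ^ 2 / x) * p ^ n * jterm p x (- int n - 1)" for n
  proof -
    define k where "k = - int n - 2"
    have k: "- int n - 1 = k + 1" "- int (Suc n) - 1 = k" by (simp_all add: k_def)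
    have "p powi k = 1 / (p ^ n * p\<^sup>2)"
      unfolding k_def using p(1) by (simp add: power_int_diff power_int_minus field_simps)
    then show ?thesis
      unfolding k jterm_step[OF p(1) x] using p(1) x by simp
  qed
  then show "summable (\<lambda>n. norm (jterm p x (- int n - 1)))"
    by (rule ratio)
qed

lemmas abs_summable_jterm = abs_summable_int_split[OF summable_jterm(1) summable_jterm(2)]

lemma has_sum_jseries:
  assumes "p \<noteq> 0" "norm p < 1" "x \<noteq> 0"
  shows "(jterm p x has_sum jseries p x) UNIV"
  unfolding jseries_def
  using has_sum_int_split[OF summable_jterm[OF assms]] by (simp add: infsumI)

lemma jseries_inverse:
  assumes "p \<noteq> 0" "norm p < 1" "x \<noteq> 0"
  shows "jseries p (1 / x) = - jseries p x / x"
proof -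
  have "(jterm p (1 / x) has_sum - (1 / x) * jseries p x) UNIV"
  proof (rule has_sum_reindex_bij_witness[where i = "\<lambda>k. 1 - k" and j = "\<lambda>k. 1 - k"
        and T = UNIV and h = "\<lambda>k. - (1 / x) * jterm p x k", THEN iffD2])
    show "((\<lambda>k. - (1 / x) * jterm p x k) has_sum - (1 / x) * jseries p x) UNIV"
      by (rule has_sum_cmult_right[OF has_sum_jseries[OF assms]])
    have "(1 - k) * (1 - k - 1) = k * (k - 1)" for k :: int by (simp add: algebra_simps)
    then show "- (1 / x) * jterm p x (1 - k) = jterm p (1 / x) k" for k
      using assms(3) by (simp add: jterm_def power_int_diff power_int_minus power_int_divide_distrib field_simps)
  qed auto
  then show ?thesis by (simp add: jseries_def infsumI)
qed

lemma jseries_mult: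
  assumes "p \<noteq> 0" "norm p < 1" "x \<noteq> 0"
  shows "jseries p (p * x) = - jseries p x / x"
proof -
  have "(jterm p (p * x) has_sum - (1 / x) * jseries p x) UNIV"
  proof (rule has_sum_reindex_bij_witness[where i = "\<lambda>k. k - 1" and j = "\<lambda>k. k + 1"
        and T = UNIV and h = "\<lambda>k. - (1 / x) * jterm p x k", THEN iffD2])
    show "((\<lambda>k. - (1 / x) * jterm p x k) has_sum - (1 / x) * jseries p x) UNIV"
      by (rule has_sum_cmult_right[OF has_sum_jseries[OF assms]])
    show "- (1 / x) * jterm p x (k + 1) = jterm p (p * x) k" for k
      using assms jterm_step[of p x k] by (simp add: jterm_def power_int_mult_distrib)
  qed auto
  then show ?thesis by (simp add: jseries_def infsumI)
qed

text \<open>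
  The even exponents \<open>k (k - 1)\<close> belong to the base \<open>p\<^sup>2\<close>, and negating the argument removes the sign.
\<close>
lemma jterm_square: "jterm (p\<^sup>2) (- u) k = p powi (k * (k - 1)) * u powi k"
proof -
  have "p\<^sup>2 powi (k * (k - 1) div 2) = p powi (2 * (k * (k - 1) div 2))"
    by (simp flip: power_int_mult power_int_numeral)
  also have "2 * (k * (k - 1) div 2) = k * (k - 1)" by simp
  finally have *: "p\<^sup>2 powi (k * (k - 1) div 2) = p powi (k * (k - 1))" .
  have "(- 1 :: complex) powi k * (- u) powi k = u powi k"
    by (simp flip: power_int_mult_distrib)
  then show ?thesis by (simp add: jterm_def * mult.commute mult.left_commute)
qed

text \<open>
  The exponent of \<open>p\<close> on the left is a quadratic form in the two indices; sum and difference of the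
  indices diagonalize it, which separates \<open>r\<close> from \<open>s\<close>.
\<close>
lemma jterm_product_even:
  assumes "p \<noteq> 0" "x \<noteq> 0" "y \<noteq> 0"
  shows "jterm p x (r + s) * jterm p y (r - s)
       = jterm (p\<^sup>2) (- (x * y)) r * jterm (p\<^sup>2) (- (p * x / y)) s"
proof -
  have "even (m * (m - 1))" for m :: int by simp
  from this[of "r + s"] this[of "r - s"]
  have "2 * ((r + s) * (r + s - 1) div 2) + 2 * ((r - s) * (r - s - 1) div 2)
      = (r + s) * (r + s - 1) + (r - s) * (r - s - 1)"
    by (simp only: even_two_times_div_two)
  also have "\<dots> = 2 * (r * (r - 1) + (s * (s - 1) + s))" by (simp add: algebra_simps)
  finally have exponent: "(r + s) * (r + s - 1) div 2 + (r - s) * (r - s - 1) div 2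
      = r * (r - 1) + (s * (s - 1) + s)" by simp
  have sign: "(- 1 :: complex) powi (r + s) * (- 1) powi (r - s) = 1"
    by (simp add: power_int_add[symmetric] flip: power_int_mult)
  have "jterm p x (r + s) * jterm p y (r - s) =
      ((- 1) powi (r + s) * (- 1) powi (r - s)) *
      p powi ((r + s) * (r + s - 1) div 2 + (r - s) * (r - s - 1) div 2)
      * (x powi (r + s) * y powi (r - s))"
    using assms by (simp add: jterm_def power_int_add)
  also have "\<dots> = p powi (r * (r - 1)) * (p powi (s * (s - 1)) * p powi s) * (x powi (r + s) * y powi (r - s))"
    unfolding exponent sign using assms by (simp add: power_int_add)
  also have "\<dots> = jterm (p\<^sup>2) (- (x * y)) r * jterm (p\<^sup>2) (- (p * x / y)) s"
    unfolding jterm_square using assms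
    by (simp add: power_int_add power_int_diff power_int_mult_distrib power_int_divide_distrib)
  finally show ?thesis .
qed

lemma jterm_product_odd:
  assumes "p \<noteq> 0" "x \<noteq> 0" "y \<noteq> 0"
  shows "jterm p x (r + s) * jterm p y (r - s + 1)
       = - y * (jterm (p\<^sup>2) (- (p * x * y)) r * jterm (p\<^sup>2) (- (x / y)) s)"
proof -
  have "jterm p x (r + s) * jterm p y (r - s + 1)
      = - y * p powi (r - s) * (jterm p x (r + s) * jterm p y (r - s))"
    unfolding jterm_step[OF assms(1,3)] by simp
  also have "\<dots> = - y * (jterm (p\<^sup>2) (- (p * x * y)) r * jterm (p\<^sup>2) (- (x / y)) s)"
    unfolding jterm_product_even[OF assms] unfolding jterm_square using assms
    by (simp add: power_int_add power_int_diff power_int_mult_distrib power_int_divide_distrib)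
  finally show ?thesis .
qed

text \<open>
  The index pairs \<open>(m, n)\<close> with \<open>m + n\<close> even are the pairs \<open>(r + s, r - s)\<close>, the others are the
  pairs \<open>(r + s, r - s + 1)\<close>.  On each of the two classes the double series factors.
\<close>
lemma jseries_product:
  assumes p: "p \<noteq> 0" "norm p < 1" and x: "x \<noteq> 0" and y: "y \<noteq> 0"
  shows "jseries p x * jseries p y =
    jseries (p\<^sup>2) (- (x * y)) * jseries (p\<^sup>2) (- (p * x / y))
    - y * (jseries (p\<^sup>2) (- (p * x * y)) * jseries (p\<^sup>2) (- (x / y)))"
proof -
  have p2: "p\<^sup>2 \<noteq> 0" "norm (p\<^sup>2) < 1"
    using p by (auto simp: norm_power power_less_one_iff abs_square_less_1)
  note prods = has_sum_product[OF abs_summable_jterm abs_summable_jterm has_sum_jseries has_sum_jseries]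
  let ?f = "\<lambda>(m, n). jterm p x m * jterm p y n"
  have halves: "(m + n) div 2 + (m - n) div 2 = m" "(m + n) div 2 - (m - n) div 2 = n"
    if "even m \<longleftrightarrow> even n" for m n :: int
  proof -
    from that have "even (m + n)" by simp
    then obtain r where r: "m + n = 2 * r" by (elim evenE)
    then have "m - n = 2 * (r - n)" by simp
    then have "(m - n) div 2 = r - n" by simp
    moreover have "(m + n) div 2 = r" using r by simp
    ultimately show "(m + n) div 2 + (m - n) div 2 = m" "(m + n) div 2 - (m - n) div 2 = n"
      using r by simp_all
  qed
  have odd_halves: "(m + n - 1) div 2 + ((m - n) div 2 + 1) = m" "(m + n - 1) div 2 - (m - n) div 2 = n"
    if "odd m \<longleftrightarrow> even n" for m n :: int
  proof -
    from that have "odd (m + n)" by auto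
    then obtain r where r: "m + n = 2 * r + 1" by (elim oddE)
    then have "m - n = 2 * (r - n) + 1" by simp
    then have "(m - n) div 2 = r - n" by simp
    moreover have "(m + n - 1) div 2 = r" using r by simp
    ultimately show "(m + n - 1) div 2 + ((m - n) div 2 + 1) = m" "(m + n - 1) div 2 - (m - n) div 2 = n"
      using r by simp_all
  qed
  have odd_term: "- (y * (jterm (p\<^sup>2) (- (p * x * y)) ((m + n - 1) div 2) * jterm (p\<^sup>2) (- (x / y)) ((m - n) div 2 + 1)))
      = jterm p x m * jterm p y n" if "odd m \<longleftrightarrow> even n" for m n
    using jterm_product_odd[OF p(1) x y, of "(m + n - 1) div 2" "(m - n) div 2 + 1"] odd_halves[OF that]
    by simp
  have total: "(?f has_sum jseries p x * jseries p y) UNIV"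
    using prods[of p x p y] p x y by simp
  have "((\<lambda>(r, s). jterm (p\<^sup>2) (- (x * y)) r * jterm (p\<^sup>2) (- (p * x / y)) s)
      has_sum jseries (p\<^sup>2) (- (x * y)) * jseries (p\<^sup>2) (- (p * x / y))) UNIV"
    using prods[of "p\<^sup>2" "- (x * y)" "p\<^sup>2" "- (p * x / y)"] p p2 x y by simp
  then have even: "(?f has_sum jseries (p\<^sup>2) (- (x * y)) * jseries (p\<^sup>2) (- (p * x / y)))
      {(m, n). even (m + n)}"
    by (rule has_sum_reindex_bij_witness[where i = "\<lambda>(r, s). (r + s, r - s)" and j = "\<lambda>(m, n). ((m + n) div 2, (m - n) div 2)"
            and T = UNIV and h = "\<lambda>(r, s). jterm (p\<^sup>2) (- (x * y)) r * jterm (p\<^sup>2) (- (p * x / y)) s", THEN iffD2, rotated -1])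
       (use p x y in \<open>auto simp: halves simp flip: jterm_product_even\<close>)
  have "((\<lambda>(r, s). - y * (jterm (p\<^sup>2) (- (p * x * y)) r * jterm (p\<^sup>2) (- (x / y)) s))
      has_sum - y * (jseries (p\<^sup>2) (- (p * x * y)) * jseries (p\<^sup>2) (- (x / y)))) UNIV"
    using has_sum_cmult_right[OF prods[of "p\<^sup>2" "- (p * x * y)" "p\<^sup>2" "- (x / y)"], of "- y"] p p2 x y
    by (simp add: case_prod_unfold)
  then have odd: "(?f has_sum - y * (jseries (p\<^sup>2) (- (p * x * y)) * jseries (p\<^sup>2) (- (x / y))))
      {(m, n). odd (m + n)}"
    by (rule has_sum_reindex_bij_witness[where i = "\<lambda>(r, s). (r + s, r - s + 1)"
            and j = "\<lambda>(m, n). ((m + n - 1) div 2, (m - n) div 2 + 1)"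
            and T = UNIV and h = "\<lambda>(r, s). - y * (jterm (p\<^sup>2) (- (p * x * y)) r * jterm (p\<^sup>2) (- (x / y)) s)", THEN iffD2, rotated -1])
       (use p x y in \<open>auto simp: odd_halves odd_term\<close>)
  have "{(m, n). even (m + n)} \<union> {(m, n). odd (m + n)} = (UNIV :: (int \<times> int) set)"
    "{(m, n). even (m + n)} \<inter> {(m :: int, n). odd (m + n)} = {}" by auto
  with has_sum_Un_disjoint[OF even odd] total show ?thesis
    using has_sum_unique by fastforce
qed

section \<open>Two polynomial identities\<close>

text \<open>
  The polynomial identity behind the addition formula.  The letters \<open>Pp\<close>, \<open>Qp\<close>, \<open>Pu\<close>, ... stand for
  the values at \<open>x\<^sub>1x\<^sub>2\<close>, \<open>x\<^sub>3x\<^sub>4\<close> (primed), \<open>x\<^sub>1/x\<^sub>2\<close> and \<open>x\<^sub>3/x\<^sub>4\<close> of the two functions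
  into which products of two theta functions decompose; their mixed terms
  cancel because \<open>x\<^sub>1x\<^sub>2x\<^sub>3x\<^sub>4 = A\<^sup>2\<close>.
\<close>
lemma weierstrass_algebra:
  fixes x1 x2 x3 x4 A :: complex
  assumes "x1 \<noteq> 0" "x2 \<noteq> 0" "x3 \<noteq> 0" "A \<noteq> 0" "x4 = A\<^sup>2 / (x1 * x2 * x3)"
  shows "(Pp * Qu - x2 * (Qp * Pu)) * (Pp' * Qv - x4 * (Qp' * Pv))
     - (Pp' * Qu - A / x1 * (Qp' * Pu)) * (Pp * Qv - A / x3 * (Qp * Pv))
     = A / x1 * ((Pp * Qp' - x1 * x2 / A * (Qp * Pp')) * (Pu * Qv - x1 * x4 / A * (Qu * Pv)))"
  using assms(1-4) unfolding assms(5) by (simp add: field_simps power2_eq_square)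

text \<open>
  Both products have degree four in \<open>z\<close>.  Their coefficients at \<open>1\<close>, \<open>z\<^sup>2\<close> and \<open>z\<^sup>4\<close> agree because
  the product of the \<open>x\<^sub>i\<close> is \<open>A\<^sup>2\<close>, and the differences at \<open>z\<close> and \<open>z\<^sup>3\<close> are in the ratio
  \<open>1 : - A\<close>.
\<close>
lemma telescoping_algebra:
  fixes x1 x2 x3 x4 A z :: complex
  assumes "x1 \<noteq> 0" "x2 \<noteq> 0" "x3 \<noteq> 0" "A \<noteq> 0" "x4 = A\<^sup>2 / (x1 * x2 * x3)"
  shows "(1 - x1 * z) * (1 - x2 * z) * (1 - x3 * z) * (1 - x4 * z)
       - (1 - A / x1 * z) * (1 - A / x2 * z) * (1 - A / x3 * z) * (1 - A / x4 * z)
     = A / x1 * (1 - x1 * x2 / A) * (1 - x1 * x3 / A) * (1 - x1 * x4 / A) * (z * (1 - A * z\<^sup>2))"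
  using assms(1-4) unfolding assms(5) by (simp add: field_simps power2_eq_square)

section \<open>The infinite q-Pochhammer symbol and the theta function\<close>

definition nome :: "complex \<Rightarrow> bool" where
  "nome q \<longleftrightarrow> q \<noteq> 0 \<and> norm q < 1"

lemma q_nonzero:
  assumes q: "nome q"
  shows "q \<noteq> 0"
  using q by (simp add: nome_def)

lemma norm_q:
  assumes q: "nome q"
  shows "norm q < 1"
  using q by (simp add: nome_def)

abbreviation poch :: "complex \<Rightarrow> complex \<Rightarrow> complex" where
  "poch q x \<equiv> qpoch_inf x q"

lemma poch_0: "poch q 0 = 1"
  by (simp add: qpoch_inf_def)

lemma poch_step:
  assumes q: "nome q"
  shows "poch q x = (1 - x) * poch q (x * q)"
  using qpoch_inf_split[OF norm_q[OF q], of x 1] by simp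

lemma poch_eq_0_iff:
  assumes q: "nome q"
  shows "poch q x = 0 \<longleftrightarrow> (\<exists>j. x * q ^ j = 1)"
proof
  assume "\<exists>j. x * q ^ j = 1"
  then obtain j where "x * q ^ j = 1" by blast
  then show "poch q x = 0"
    using qpoch_inf_split[OF norm_q[OF q], of x "Suc j"] by simp
qed (use qpoch_inf_nonzero[OF norm_q[OF q]] in blast)

lemma continuous_poch:
  assumes q: "nome q"
  shows "continuous_on UNIV (poch q)"
proof -
  have "continuous_on (cball 0 R) (poch q)" for R
  proof (rule uniform_limit_theorem)
    have *: "uniformly_convergent_on (cball 0 R) (\<lambda>N x. \<Prod>n<N. 1 + (- x * q ^ n))"
    proof (rule uniformly_convergent_on_prod)
      show "uniformly_convergent_on (cball 0 R) (\<lambda>N x. \<Sum>n<N. norm (- x * q ^ n))"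
      proof (rule Weierstrass_m_test')
        show "summable (\<lambda>n. R * norm q ^ n)"
          using norm_q[OF q] by (intro summable_mult summable_geometric) simp
      qed (auto simp: norm_mult norm_power intro!: mult_right_mono)
    qed (auto intro!: continuous_intros)
    have "lim (\<lambda>N. \<Prod>n<N. 1 + (- x * q ^ n)) = poch q x" for x
      using convergent_prod_LIMSEQ[OF convergent_prod_qpoch[OF norm_q[OF q], of x]]
      by (intro limI) (simp add: qpoch_inf_def LIMSEQ_lessThan_iff_atMost)
    then show "uniform_limit (cball 0 R) (\<lambda>N x. \<Prod>n<N. 1 + (- x * q ^ n)) (poch q) sequentially"
      using * by (simp add: uniformly_convergent_uniform_limit_iff)
  qed (auto intro!: continuous_intros always_eventually)
  then have "isCont (poch q) x" for x
    using continuous_on_interior[of "cball 0 (norm x + 1)" "poch q" x] by simp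
  then show ?thesis
    by (simp add: continuous_at_imp_continuous_on)
qed

lemma tendsto_poch:
  assumes q: "nome q"
  shows "(f \<longlongrightarrow> x) F \<Longrightarrow> ((\<lambda>n. poch q (f n)) \<longlongrightarrow> poch q x) F"
  by (rule continuous_on_tendsto_compose[OF continuous_poch[OF q]]) auto

lemma continuous_on_poch:
  assumes q: "nome q"
  shows "continuous_on S f \<Longrightarrow> continuous_on S (\<lambda>z. poch q (f z))"
  by (rule continuous_on_compose2[OF continuous_poch[OF q]]) auto

lemma tendsto_power_q:
  assumes q: "nome q"
  shows "(\<lambda>n. q ^ n) \<longlonglongrightarrow> 0"
  using norm_q[OF q] by (rule LIMSEQ_power_zero)

definition theta :: "complex \<Rightarrow> complex \<Rightarrow> complex" where
  "theta q x = poch q x * poch q (q / x)"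

text \<open>
  The quotient \<open>\<theta>(x) / (1 - x)\<close> with the removable singularity at \<open>1\<close> filled in.
\<close>
definition theta_red :: "complex \<Rightarrow> complex \<Rightarrow> complex" where
  "theta_red q x = poch q (x * q) * poch q (q / x)"

lemma theta_eq:
  assumes q: "nome q"
  shows "theta q x = (1 - x) * theta_red q x"
  using poch_step[OF q, of x] by (simp add: theta_def theta_red_def)

lemma theta_inverse:
  assumes q: "nome q"
    and "x \<noteq> 0"
  shows "theta q (1 / x) = - theta q x / x"
proof -
  have "theta q (1 / x) = (1 - 1 / x) * poch q (q / x) * poch q (x * q)"
    unfolding theta_def using poch_step[OF q, of "1 / x"] by (simp add: mult.commute)
  also have "\<dots> = - theta q x / x"
    unfolding theta_def poch_step[OF q, of x] using assms by (simp add: field_simps)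
  finally show ?thesis .
qed

lemma theta_mult_q:
  assumes q: "nome q"
    and "x \<noteq> 0"
  shows "theta q (q * x) = - theta q x / x"
proof -
  have "theta q (q * x) = poch q (x * q) * ((1 - 1 / x) * poch q (q / x))"
    unfolding theta_def using poch_step[OF q, of "1 / x"] q_nonzero[OF q] by (simp add: mult.commute)
  also have "\<dots> = - theta q x / x"
    unfolding theta_def poch_step[OF q, of x] using assms by (simp add: field_simps)
  finally show ?thesis .
qed

lemma theta_div_q:
  assumes q: "nome q"
  shows "x \<noteq> 0 \<Longrightarrow> theta q (x / q) = - (x / q) * theta q x"
  using theta_mult_q[OF q, of "x / q"] q_nonzero[OF q] by (simp add: field_simps)

lemma theta_eq_0_iff:
  assumes q: "nome q"
    and "x \<noteq> 0"
  shows "theta q x = 0 \<longleftrightarrow> (\<exists>m. x = q powi m)"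
proof
  assume "theta q x = 0"
  then consider j where "x * q ^ j = 1" | j where "q / x * q ^ j = 1"
    by (auto simp: theta_def poch_eq_0_iff[OF q])
  then show "\<exists>m. x = q powi m"
  proof cases
    case 1
    then have "x = q powi (- int j)" using q_nonzero[OF q] by (simp add: power_int_minus field_simps)
    then show ?thesis by blast
  next
    case 2
    then have "x = q powi (int (Suc j))" using q_nonzero[OF q] assms
      by (simp only: power_int_of_nat) (simp add: field_simps)
    then show ?thesis by blast
  qed
next
  assume "\<exists>m. x = q powi m"
  then obtain m where m: "x = q powi m" by blast
  show "theta q x = 0"
  proof (cases "m \<le> 0")
    case True
    define j where "j = nat (- m)"
    have "m = - int j" using True by (simp add: j_def)
    then have "q powi m * q ^ j = 1"
      using q_nonzero[OF q] by (simp add: power_int_minus)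
    then show ?thesis using m by (auto simp: theta_def poch_eq_0_iff[OF q])
  next
    case False
    define j where "j = nat (m - 1)"
    have "m = int (Suc j)" using False by (simp add: j_def)
    then have "q / q powi m * q ^ j = 1"
      using q_nonzero[OF q] by (simp only: power_int_of_nat) simp
    then show ?thesis using m by (auto simp: theta_def poch_eq_0_iff[OF q])
  qed
qed

section \<open>The Jacobi triple product\<close>

lemma poch_powi_nonpos:
  assumes q: "nome q"
  shows "m \<le> 0 \<Longrightarrow> poch q (q powi m) = 0"
proof -
  assume "m \<le> 0"
  then have "m = - int (nat (- m))" by simp
  then have "q powi m * q ^ nat (- m) = 1"
    using q_nonzero[OF q] by (metis power_int_minus power_int_of_nat left_inverse power_not_zero)
  then show ?thesis by (auto simp: poch_eq_0_iff[OF q])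
qed

lemma poch_power_nonzero:
  assumes q: "nome q"
  shows "poch q (q ^ Suc n) \<noteq> 0"
proof
  assume "poch q (q ^ Suc n) = 0"
  then obtain j where "q ^ Suc n * q ^ j = 1" by (auto simp: poch_eq_0_iff[OF q])
  then have "norm q ^ Suc (n + j) = 1" by (metis add_Suc norm_one norm_power power_add)
  then show False using norm_q[OF q] power_Suc_less_one[of "norm q" "n + j"] q_nonzero[OF q] by simp
qed

lemma poch_q_nonzero:
  assumes q: "nome q"
  shows "poch q q \<noteq> 0"
  using poch_power_nonzero[OF q, of 0] by simp

text \<open>
  For nonpositive exponents the symbol vanishes, and for positive ones it converges to \<open>1\<close>.
\<close>
lemma bounded_poch_powi:
  assumes q: "nome q"
  shows "\<exists>B. \<forall>m. norm (poch q (q powi m)) \<le> B"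
proof -
  have "(\<lambda>n. poch q (q ^ n)) \<longlonglongrightarrow> poch q 0"
    by (intro tendsto_intros tendsto_poch[OF q] tendsto_power_q[OF q])
  then have "Bseq (\<lambda>n. poch q (q ^ n))"
    using convergentI convergent_imp_Bseq by blast
  then obtain B where B: "norm (poch q (q ^ n)) \<le> B" for n
    by (auto simp: Bseq_def)
  have "norm (poch q (q powi m)) \<le> B" for m
  proof (cases "m \<le> 0")
    case True
    then show ?thesis using poch_powi_nonpos[OF q True] order_trans[OF norm_ge_zero B[of 0]] by simp
  next
    case False
    then show ?thesis using B[of "nat m"] by (simp flip: power_int_of_nat)
  qed
  then show ?thesis by blast
qed

lemma tendsto_powi_q:
  assumes q: "nome q"
  shows "(\<lambda>n. q powi (int n + k)) \<longlonglongrightarrow> 0"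
proof -
  have "(\<lambda>n. q ^ n * q powi k) \<longlonglongrightarrow> 0 * q powi k"
    by (intro tendsto_intros tendsto_poch[OF q] tendsto_power_q[OF q])
  then show ?thesis using q_nonzero[OF q] by (simp add: power_int_add)
qed

text \<open>
  A finite form of the triple product.  The Gaussian binomial coefficient
  \<open>(q)\<^sub>2\<^sub>n / ((q)\<^sub>n\<^sub>-\<^sub>k (q)\<^sub>n\<^sub>+\<^sub>k)\<close> is written, up to a factor free of \<open>k\<close>, as
  \<open>(q\<^bsup>n-k+1\<^esup>)\<^sub>\<infinity> (q\<^bsup>n+k+1\<^esup>)\<^sub>\<infinity>\<close>: this vanishes by itself for \<open>\<bar>k\<bar> > n\<close>, so that the finite sum
  becomes a sum over all integers, and its limit for \<open>n \<rightarrow> \<infinity>\<close> is visibly \<open>1\<close>.  In the induction step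
  the two new factors of the product multiply out to a three-term recurrence for
  the coefficients.
\<close>
lemma finite_triple_product:
  assumes q: "nome q"
    and x: "x \<noteq> 0"
  shows "((\<lambda>k. jterm q x k * (poch q (q powi (int n - k + 1)) * poch q (q powi (int n + k + 1)))) has_sum
     poch q (q ^ (2 * n + 1)) * poch q q * (\<Prod>i<n. (1 - x * q ^ i) * (1 - q ^ Suc i / x))) UNIV"
proof (induction n)
  case 0
  have "poch q (q powi (1 - k)) * poch q (q powi (k + 1)) = 0" if "k \<noteq> 0" for k
    using poch_powi_nonpos[OF q, of "1 - k"] poch_powi_nonpos[OF q, of "k + 1"] that by (cases "k > 0") auto
  then have "((\<lambda>k. jterm q x k * (poch q (q powi (1 - k)) * poch q (q powi (k + 1)))) has_sum
      (\<Sum>k\<in>{0}. jterm q x k * (poch q (q powi (1 - k)) * poch q (q powi (k + 1))))) UNIV"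
    by (intro has_sum_finite_neutralI[where B = "{0}"]) auto
  then show ?case by (simp add: jterm_def)
next
  case (Suc n)
  let ?d = "\<lambda>n k. poch q (q powi (int n - k + 1)) * poch q (q powi (int n + k + 1))"
  define Q where "Q = q ^ (2 * n + 1)"
  define S where "S = poch q (q ^ (2 * n + 1)) * poch q q * (\<Prod>i<n. (1 - x * q ^ i) * (1 - q ^ Suc i / x))"
  have IH: "((\<lambda>k. jterm q x k * ?d n k) has_sum S) UNIV"
    using Suc.IH by (simp add: S_def)
  have below: "((\<lambda>k. jterm q x (k - 1) * ?d n (k - 1)) has_sum S) UNIV"
    using IH by (subst has_sum_reindex_bij_betw[where g = "\<lambda>k. k - 1" and f = "\<lambda>k. jterm q x k * ?d n k" and B = UNIV])
      (auto intro!: bij_betwI[of _ _ _ "\<lambda>k. k + 1"])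
  have above: "((\<lambda>k. jterm q x (k + 1) * ?d n (k + 1)) has_sum S) UNIV"
    using IH by (subst has_sum_reindex_bij_betw[where g = "\<lambda>k. k + 1" and f = "\<lambda>k. jterm q x k * ?d n k" and B = UNIV])
      (auto intro!: bij_betwI[of _ _ _ "\<lambda>k. k - 1"])
  have recurrence: "(1 - Q) * (1 - Q * q) * (jterm q x k * ?d (Suc n) k)
      = (1 + Q) * (jterm q x k * ?d n k)
        + - (x * q ^ n) * (jterm q x (k - 1) * ?d n (k - 1))
        + - (q ^ Suc n / x) * (jterm q x (k + 1) * ?d n (k + 1))" for k
  proof -
    \<comment> \<open>In terms of \<open>X\<close> and \<open>Y\<close>, with \<open>X Y = q Q\<close>, the recurrence is a polynomial identity.\<close>
    define X where "X = q powi (int n - k + 1)"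
    define Y where "Y = q powi (int n + k + 1)"
    have XY: "X * Y = q * Q"
    proof -
      have "X * Y = q powi ((int n - k + 1) + (int n + k + 1))"
        unfolding X_def Y_def using q_nonzero[OF q] by (simp only: power_int_add simp_thms)
      also have "(int n - k + 1) + (int n + k + 1) = int (2 * n + 2)" by simp
      finally have "X * Y = q powi int (2 * n + 2)" .
      then show ?thesis by (simp only: power_int_of_nat) (simp add: Q_def)
    qed
    define u where "u = poch q (X * q)"
    define v where "v = poch q (Y * q)"
    have X: "poch q X = (1 - X) * u" "poch q (X / q) = (1 - X / q) * ((1 - X) * u)"
      and Y: "poch q Y = (1 - Y) * v" "poch q (Y / q) = (1 - Y / q) * ((1 - Y) * v)"
      using poch_step[OF q, of X] poch_step[OF q, of "X / q"] poch_step[OF q, of Y] poch_step[OF q, of "Y / q"] q_nonzero[OF q]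
      by (simp_all add: u_def v_def)
    have d: "?d (Suc n) k = u * v" "?d n k = (1 - X) * u * ((1 - Y) * v)"
       "?d n (k - 1) = u * ((1 - Y / q) * ((1 - Y) * v))"
       "?d n (k + 1) = (1 - X / q) * ((1 - X) * u) * v"
    proof -
      have e: "q powi (int (Suc n) - k + 1) = X * q" "q powi (int (Suc n) + k + 1) = Y * q"
        "q powi (int n - (k - 1) + 1) = X * q" "q powi (int n + (k - 1) + 1) = Y / q"
        "q powi (int n - (k + 1) + 1) = X / q" "q powi (int n + (k + 1) + 1) = Y * q"
        unfolding X_def Y_def using q_nonzero[OF q]
        by (simp_all add: power_int_add power_int_diff power2_eq_square)
      show "?d (Suc n) k = u * v" "?d n k = (1 - X) * u * ((1 - Y) * v)"
       "?d n (k - 1) = u * ((1 - Y / q) * ((1 - Y) * v))"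
       "?d n (k + 1) = (1 - X / q) * ((1 - X) * u) * v"
        unfolding e by (simp_all only: X Y u_def[symmetric] v_def[symmetric] X_def[symmetric] Y_def[symmetric])
    qed
    have "jterm q x k = - x * q powi (k - 1) * jterm q x (k - 1)"
      using jterm_step[OF q_nonzero[OF q] x, of "k - 1"] by simp
    then have below: "- (x * q ^ n) * jterm q x (k - 1) = X * jterm q x k"
      using q_nonzero[OF q] by (simp add: X_def power_int_add power_int_diff)
    have above: "- (q ^ Suc n / x) * jterm q x (k + 1) = Y * jterm q x k"
      using q_nonzero[OF q] x by (simp add: jterm_step Y_def power_int_add)
    have Q: "Q = X * Y / q" using XY q_nonzero[OF q] by simp
    have "(1 - Q) * (1 - Q * q) * (u * v) = (1 + Q) * ((1 - X) * u * ((1 - Y) * v))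
        + X * (u * ((1 - Y / q) * ((1 - Y) * v))) + Y * ((1 - X / q) * ((1 - X) * u) * v)"
      unfolding Q using q_nonzero[OF q] by (simp add: field_simps)
    then have "(1 - Q) * (1 - Q * q) * ?d (Suc n) k = (1 + Q) * ?d n k + X * ?d n (k - 1) + Y * ?d n (k + 1)"
      unfolding d .
    moreover have "c * (J * e) = s * (J * d) + v * (J1 * d1) + w * (J2 * d2)"
      if "c * e = s * d + X * d1 + Y * d2" "v * J1 = X * J" "w * J2 = Y * J"
      for c s v w J J1 J2 e d d1 d2 :: complex
      using that by algebra
    ultimately show ?thesis using below above by blast
  qed
  have "((\<lambda>k. (1 - Q) * (1 - Q * q) * (jterm q x k * ?d (Suc n) k)) has_sum
      (1 + Q) * S + - (x * q ^ n) * S + - (q ^ Suc n / x) * S) UNIV"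
    unfolding recurrence by (intro has_sum_add has_sum_cmult_right IH below above)
  also have "(1 + Q) * S + - (x * q ^ n) * S + - (q ^ Suc n / x) * S
      = S * ((1 - x * q ^ n) * (1 - q ^ Suc n / x))"
  proof -
    have "Q = q ^ n * q ^ Suc n" by (simp add: Q_def mult_2 power_add)
    then show ?thesis using x by (simp add: field_simps)
  qed
  also have "S = (1 - Q) * (1 - Q * q) * (poch q (q ^ (2 * Suc n + 1)) * poch q q
      * (\<Prod>i<n. (1 - x * q ^ i) * (1 - q ^ Suc i / x)))"
    using poch_step[OF q, of Q] poch_step[OF q, of "Q * q"] by (simp add: S_def Q_def mult_ac)
  finally have scaled: "((\<lambda>k. (1 - Q) * (1 - Q * q) * (jterm q x k * ?d (Suc n) k)) has_sum
      (1 - Q) * (1 - Q * q) * (poch q (q ^ (2 * Suc n + 1)) * poch q q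
      * (\<Prod>i<Suc n. (1 - x * q ^ i) * (1 - q ^ Suc i / x)))) UNIV"
    by (simp add: mult_ac)
  have nz: "(1 - Q) * (1 - Q * q) \<noteq> 0"
    using poch_power_nonzero[OF q, of "2 * n"] poch_step[OF q, of Q] poch_step[OF q, of "Q * q"]
    by (auto simp: Q_def)
  have cancel: "(f has_sum R) UNIV" if "((\<lambda>k. C * f k) has_sum C * R) UNIV" "C \<noteq> 0"
    for C R and f :: "int \<Rightarrow> complex"
    using has_sum_cmult_right[OF that(1), of "inverse C"] that(2) by (simp flip: mult.assoc)
  from cancel[OF scaled nz] show ?case .
qed

lemma tendsto_poch_finite:
  assumes q: "nome q"
  shows "(\<lambda>n. \<Prod>i<n. 1 - x * q ^ i) \<longlonglongrightarrow> poch q x"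
  using convergent_prod_LIMSEQ[OF convergent_prod_qpoch[OF norm_q[OF q], of x]]
  by (simp add: qpoch_inf_def LIMSEQ_lessThan_iff_atMost)

theorem jacobi_triple_product:
  assumes q: "nome q"
    and x: "x \<noteq> 0"
  shows "poch q q * theta q x = jseries q x"
proof -
  obtain B where B: "\<And>m. norm (poch q (q powi m)) \<le> B" using bounded_poch_powi[OF q] by blast
  have "(\<lambda>n. \<Sum>\<^sub>\<infinity>k. jterm q x k * (poch q (q powi (int n - k + 1)) * poch q (q powi (int n + k + 1))))
      \<longlonglongrightarrow> (\<Sum>\<^sub>\<infinity>k. jterm q x k)"
  proof (rule infsum_int_dominated[where M = "\<lambda>k. norm (jterm q x k) * (B * B)"])
    show "(\<lambda>n. jterm q x k * (poch q (q powi (int n - k + 1)) * poch q (q powi (int n + k + 1))))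
        \<longlonglongrightarrow> jterm q x k" for k
      using tendsto_mult[OF tendsto_const[of "jterm q x k"] tendsto_mult[OF
          tendsto_poch[OF q tendsto_powi_q[OF q, of "1 - k"]] tendsto_poch[OF q tendsto_powi_q[OF q, of "k + 1"]]]]
      by (simp add: poch_0 algebra_simps)
    show "norm (jterm q x k * (poch q (q powi (int n - k + 1)) * poch q (q powi (int n + k + 1))))
        \<le> norm (jterm q x k) * (B * B)" for k n
      unfolding norm_mult using B order_trans[OF norm_ge_zero B] by (intro mult_left_mono mult_mono) auto
  qed (use summable_jterm[OF q_nonzero[OF q] norm_q[OF q] x] in \<open>auto intro: summable_mult2\<close>)
  moreover have "(\<lambda>n. poch q (q ^ (2 * n + 1)) * poch q q * (\<Prod>i<n. (1 - x * q ^ i) * (1 - q ^ Suc i / x)))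
      \<longlonglongrightarrow> poch q 0 * poch q q * (poch q x * poch q (q / x))"
  proof (intro tendsto_mult tendsto_poch[OF q] tendsto_const)
    show "(\<lambda>n. q ^ (2 * n + 1)) \<longlonglongrightarrow> 0"
      using LIMSEQ_subseq_LIMSEQ[OF tendsto_power_q[OF q], of "\<lambda>n. 2 * n + 1"]
      by (simp add: o_def strict_mono_def)
    show "(\<lambda>n. \<Prod>i<n. (1 - x * q ^ i) * (1 - q ^ Suc i / x)) \<longlonglongrightarrow> poch q x * poch q (q / x)"
      using tendsto_mult[OF tendsto_poch_finite[OF q, of x] tendsto_poch_finite[OF q, of "q / x"]]
      by (simp add: prod.distrib)
  qed
  ultimately show ?thesis
    using LIMSEQ_unique unfolding infsumI[OF finite_triple_product[OF q x]]
    by (simp add: jseries_def theta_def poch_0) blast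
qed

section \<open>The addition formula\<close>

text \<open>
  The three-term relation of Weierstrass.  Each of the three terms is expanded in products of the
  functions \<open>P\<close> and \<open>R\<close> by \<open>jseries_product\<close>, and the expansions are compared.
\<close>
lemma theta_addition:
  assumes q: "nome q"
    and nz: "x1 \<noteq> 0" "x2 \<noteq> 0" "x3 \<noteq> 0" "x4 \<noteq> 0" "A \<noteq> 0" and A: "x1 * x2 * x3 * x4 = A\<^sup>2"
  shows "theta q x1 * theta q x2 * theta q x3 * theta q x4
      - theta q (A / x1) * theta q (A / x2) * theta q (A / x3) * theta q (A / x4)
      = A / x1 * (theta q A * theta q (x1 * x2 / A) * theta q (x1 * x3 / A) * theta q (x1 * x4 / A))"
proof -
  let ?J = "jseries q"
  define P where "P u = jseries (q\<^sup>2) (- u)" for u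
  define R where "R u = jseries (q\<^sup>2) (- (q * u))" for u
  have q2: "q\<^sup>2 \<noteq> 0" "norm (q\<^sup>2) < 1"
    using q_nonzero[OF q] norm_q[OF q] by (auto simp: norm_power power_less_one_iff abs_square_less_1)
  have product: "?J x * ?J y = P (x * y) * R (x / y) - y * (R (x * y) * P (x / y))"
    if "x \<noteq> 0" "y \<noteq> 0" for x y
    using jseries_product[OF q_nonzero[OF q] norm_q[OF q] that] by (simp add: P_def R_def mult.assoc)
  have P_inv: "P (1 / u) = P u / u" if "u \<noteq> 0" for u
    using jseries_inverse[OF q2, of "- u"] that by (simp add: P_def)
  have R_inv: "R (1 / u) = R u" if "u \<noteq> 0" for u
    using jseries_inverse[OF q2, of "- u / q"] jseries_mult[OF q2, of "- u / q"] q_nonzero[OF q] that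
    by (simp add: R_def power2_eq_square)
  define u where "u = x1 / x2"
  define v where "v = x3 / x4"
  define s where "s = x1 * x2"
  define t where "t = x3 * x4"
  have st: "s * t = A\<^sup>2" using A by (simp add: s_def t_def mult_ac)
  have uv: "u \<noteq> 0" "v \<noteq> 0" using nz by (auto simp: u_def v_def)
  have x4: "x4 = A\<^sup>2 / (x1 * x2 * x3)" using A nz by (simp add: field_simps)
  have "?J x1 * ?J x2 = P s * R u - x2 * (R s * P u)"
    using product[of x1 x2] nz by (simp add: s_def u_def)
  moreover have "?J x3 * ?J x4 = P t * R v - x4 * (R t * P v)"
    using product[of x3 x4] nz by (simp add: t_def v_def)
  moreover have "?J (A / x1) * ?J (A / x2) = P t * R u - A / x1 * (R t * P u)"
  proof -
    have "A / x1 * (A / x2) = t" "A / x1 / (A / x2) = 1 / u"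
      using A nz by (auto simp: t_def u_def field_simps power2_eq_square)
    then show ?thesis
      using product[of "A / x1" "A / x2"] nz P_inv[OF uv(1)] R_inv[OF uv(1)] by (simp add: u_def)
  qed
  moreover have "?J (A / x3) * ?J (A / x4) = P s * R v - A / x3 * (R s * P v)"
  proof -
    have "A / x3 * (A / x4) = s" "A / x3 / (A / x4) = 1 / v"
      using A nz by (auto simp: s_def v_def field_simps power2_eq_square)
    then show ?thesis
      using product[of "A / x3" "A / x4"] nz P_inv[OF uv(2)] R_inv[OF uv(2)] by (simp add: v_def)
  qed
  moreover have "?J A * ?J (x1 * x2 / A) = P s * R t - x1 * x2 / A * (R s * P t)"
  proof -
    have "A * (x1 * x2 / A) = s" "A / (x1 * x2 / A) = t"
      using A nz by (auto simp: s_def t_def field_simps power2_eq_square)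
    then show ?thesis using product[of A "x1 * x2 / A"] nz by (simp only:) (simp add: s_def)
  qed
  moreover have "?J (x1 * x3 / A) * ?J (x1 * x4 / A) = P u * R v - x1 * x4 / A * (R u * P v)"
  proof -
    have "x1 * x3 / A * (x1 * x4 / A) = u" "x1 * x3 / A / (x1 * x4 / A) = v"
      using A nz by (auto simp: u_def v_def field_simps power2_eq_square)
    then show ?thesis using product[of "x1 * x3 / A" "x1 * x4 / A"] nz by (simp only:) simp
  qed
  ultimately have "(?J x1 * ?J x2) * (?J x3 * ?J x4) - (?J (A / x1) * ?J (A / x2)) * (?J (A / x3) * ?J (A / x4))
      = A / x1 * ((?J A * ?J (x1 * x2 / A)) * (?J (x1 * x3 / A) * ?J (x1 * x4 / A)))"
    using weierstrass_algebra[OF nz(1,2,3,5) x4] by simp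
  then have "poch q q ^ 4 * (theta q x1 * theta q x2 * theta q x3 * theta q x4
      - theta q (A / x1) * theta q (A / x2) * theta q (A / x3) * theta q (A / x4))
      = poch q q ^ 4 * (A / x1 * (theta q A * theta q (x1 * x2 / A) * theta q (x1 * x3 / A) * theta q (x1 * x4 / A)))"
    using nz by (simp add: power4_eq_xxxx right_diff_distrib mult_ac flip: jacobi_triple_product[OF q])
  then show ?thesis using poch_q_nonzero[OF q] by (simp only: mult_cancel_left power_eq_0_iff) simp
qed

section \<open>A very-well-poised bilateral sum\<close>

lemma tendsto_theta:
  assumes q: "nome q"
  shows "(f \<longlongrightarrow> x) F \<Longrightarrow> x \<noteq> 0 \<Longrightarrow> ((\<lambda>n. theta q (f n)) \<longlongrightarrow> theta q x) F"
  unfolding theta_def by (intro tendsto_intros tendsto_poch[OF q])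

lemma tendsto_theta_red:
  assumes q: "nome q"
  shows "(f \<longlongrightarrow> x) F \<Longrightarrow> x \<noteq> 0 \<Longrightarrow> ((\<lambda>n. theta_red q (f n)) \<longlongrightarrow> theta_red q x) F"
  unfolding theta_red_def by (intro tendsto_intros tendsto_poch[OF q])

lemmas limits = tendsto_poch tendsto_theta tendsto_theta_red

lemma poch_powi_nonzero:
  assumes q: "nome q"
    and "x \<noteq> 0" "theta q x \<noteq> 0"
  shows "poch q (x * q powi k) \<noteq> 0"
proof
  assume "poch q (x * q powi k) = 0"
  then obtain j where "x * q powi k * q ^ j = 1" by (auto simp: poch_eq_0_iff[OF q])
  then have "x * q powi (k + int j) = 1"
    using q_nonzero[OF q] by (simp add: power_int_add mult.assoc)
  then have "x = q powi (- (k + int j))"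
    unfolding power_int_minus using inverse_unique[of "q powi (k + int j)" x]
    by (simp add: mult.commute)
  then show False using assms theta_eq_0_iff[OF q] by blast
qed

text \<open>
  The parameters for which no symbol in the bilateral series, nor in its reflection \<open>k \<mapsto> - k\<close>, has
  a zero: neither \<open>x\<close> nor \<open>A / x\<close> is an integer power of \<open>q\<close>.  In terms of theta functions the
  condition is visibly open in \<open>x\<close>.
\<close>
definition regular :: "complex \<Rightarrow> complex \<Rightarrow> complex \<Rightarrow> bool" where
  "regular q A x \<longleftrightarrow> x \<noteq> 0 \<and> theta q x \<noteq> 0 \<and> theta q (A / x) \<noteq> 0"

definition poch_ratio :: "complex \<Rightarrow> complex \<Rightarrow> complex \<Rightarrow> int \<Rightarrow> complex" where
  "poch_ratio q A x k = poch q (A / x * q powi (k + 1)) / poch q (x * q powi k)"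

text \<open>
  The term of a very-well-poised bilateral series with \<open>(x)\<^sub>k\<close> replaced by
  \<open>1 / (x q\<^sup>k)\<^sub>\<infinity>\<close> and \<open>1 / (A q / x)\<^sub>k\<close> by \<open>(A q\<^bsup>k+1\<^esup> / x)\<^sub>\<infinity>\<close>; the factors free of \<open>k\<close> are left out.
\<close>
definition vwp_term :: "complex \<Rightarrow> complex \<Rightarrow> complex \<Rightarrow> complex \<Rightarrow> complex \<Rightarrow> complex \<Rightarrow> int \<Rightarrow> complex" where
  "vwp_term q A x1 x2 x3 x4 k = q powi k * (1 - A * q powi (2 * k)) *
     (poch_ratio q A x1 k * poch_ratio q A x2 k * poch_ratio q A x3 k * poch_ratio q A x4 k)"

text \<open>
  The values are those of a continuous function on the product of the compact sets
  \<open>{0} \<union> {q\<^sup>k}\<close> and \<open>{X} \<union> {x\<^sub>m}\<close>.  Bounds that hold along a convergent sequence of parameters are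
  needed for the limit in \<open>vwp_sum\<close>; constant sequences give summability.
\<close>
lemma poch_ratio_bounded:
  fixes x :: "nat \<Rightarrow> complex"
  assumes q: "nome q"
    and lim: "x \<longlonglongrightarrow> X" and X: "X \<noteq> 0" "theta q X \<noteq> 0"
    and x: "\<And>m. x m \<noteq> 0" "\<And>m. theta q (x m) \<noteq> 0"
  shows "\<exists>B. \<forall>m k. norm (poch_ratio q A (x m) (int k)) \<le> B"
proof -
  let ?Z = "insert 0 (range (\<lambda>k. q ^ k))" and ?X = "insert X (range x)"
  let ?h = "\<lambda>p. poch q (A / snd p * (fst p * q)) / poch q (snd p * fst p)"
  have "compact (?Z \<times> ?X)"
    by (intro compact_Times compact_sequence_with_limit tendsto_power_q[OF q] lim)
  moreover have "poch q (y * q ^ k) \<noteq> 0" if "y \<in> ?X" for y k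
    using that poch_powi_nonzero[OF q, of y "int k"] X x by auto
  then have nz: "poch q (y * z) \<noteq> 0" if "y \<in> ?X" "z \<in> ?Z" for y z
    using that by (auto simp: poch_0)
  have "continuous_on (?Z \<times> ?X) ?h"
  proof (rule continuous_on_divide)
    show "continuous_on (?Z \<times> ?X) (\<lambda>p. poch q (A / snd p * (fst p * q)))"
      by (intro continuous_intros continuous_on_poch[OF q]) (use X x in auto)
    show "continuous_on (?Z \<times> ?X) (\<lambda>p. poch q (snd p * fst p))"
      by (intro continuous_intros continuous_on_poch[OF q])
    show "\<forall>p\<in>?Z \<times> ?X. poch q (snd p * fst p) \<noteq> 0"
      using nz by (metis mem_Times_iff)
  qed
  ultimately have "bounded (?h ` (?Z \<times> ?X))"
    by (intro compact_imp_bounded compact_continuous_image)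
  then obtain B where B: "norm (?h p) \<le> B" if "p \<in> ?Z \<times> ?X" for p
    unfolding bounded_iff by blast
  have "norm (poch_ratio q A (x m) (int k)) \<le> B" for m k
    using B[of "(q ^ k, x m)"] q_nonzero[OF q] by (auto simp: poch_ratio_def power_int_add)
  then show ?thesis by blast
qed

lemma vwp_forward_bound:
  fixes x1 x2 x3 x4 :: "nat \<Rightarrow> complex"
  assumes q: "nome q"
    and lim: "x1 \<longlonglongrightarrow> X1" "x2 \<longlonglongrightarrow> X2" "x3 \<longlonglongrightarrow> X3" "x4 \<longlonglongrightarrow> X4"
    and X: "X1 \<noteq> 0" "theta q X1 \<noteq> 0" "X2 \<noteq> 0" "theta q X2 \<noteq> 0" "X3 \<noteq> 0" "theta q X3 \<noteq> 0" "X4 \<noteq> 0" "theta q X4 \<noteq> 0"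
    and x: "\<And>m. x1 m \<noteq> 0" "\<And>m. theta q (x1 m) \<noteq> 0" "\<And>m. x2 m \<noteq> 0" "\<And>m. theta q (x2 m) \<noteq> 0"
       "\<And>m. x3 m \<noteq> 0" "\<And>m. theta q (x3 m) \<noteq> 0" "\<And>m. x4 m \<noteq> 0" "\<And>m. theta q (x4 m) \<noteq> 0"
  shows "\<exists>B. \<forall>m k. norm (vwp_term q A (x1 m) (x2 m) (x3 m) (x4 m) (int k)) \<le> B * norm q ^ k"
proof -
  obtain B1 where B1: "norm (poch_ratio q A (x1 m) (int k)) \<le> B1" for m k
    using poch_ratio_bounded[OF q lim(1) X(1,2) x(1,2)] by blast
  obtain B2 where B2: "norm (poch_ratio q A (x2 m) (int k)) \<le> B2" for m k
    using poch_ratio_bounded[OF q lim(2) X(3,4) x(3,4)] by blast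
  obtain B3 where B3: "norm (poch_ratio q A (x3 m) (int k)) \<le> B3" for m k
    using poch_ratio_bounded[OF q lim(3) X(5,6) x(5,6)] by blast
  obtain B4 where B4: "norm (poch_ratio q A (x4 m) (int k)) \<le> B4" for m k
    using poch_ratio_bounded[OF q lim(4) X(7,8) x(7,8)] by blast
  have pos: "0 \<le> B1" "0 \<le> B2" "0 \<le> B3" "0 \<le> B4"
    using B1 B2 B3 B4 norm_ge_zero order_trans by blast+
  have "norm (1 - A * q powi (2 * int k)) \<le> 1 + norm A" for k
  proof -
    have "norm (A * q powi (2 * int k)) = norm A * norm q ^ (2 * k)"
      by (simp add: norm_mult norm_power power_int_mult power_mult)
    also have "\<dots> \<le> norm A * 1"
      using norm_q[OF q] by (intro mult_left_mono power_le_one) auto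
    finally show ?thesis using norm_triangle_ineq4[of 1 "A * q powi (2 * int k)"] by simp
  qed
  then have "norm (vwp_term q A (x1 m) (x2 m) (x3 m) (x4 m) (int k))
     \<le> norm q ^ k * (1 + norm A) * (B1 * B2 * B3 * B4)" for m k
    unfolding vwp_term_def norm_mult using pos
    by (intro mult_mono B1 B2 B3 B4) (auto simp: norm_power intro!: mult_nonneg_nonneg)
  then show ?thesis by (intro exI[of _ "(1 + norm A) * (B1 * B2 * B3 * B4)"]) (simp add: mult_ac)
qed

text \<open>
  The limit of the antidifference at \<open>-\<infinity>\<close>, and the constant in the reflection formula.
\<close>
definition theta_quotient :: "complex \<Rightarrow> complex \<Rightarrow> complex \<Rightarrow> complex \<Rightarrow> complex \<Rightarrow> complex \<Rightarrow> complex" where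
  "theta_quotient q A x1 x2 x3 x4 = theta q (A / x1) / theta q x1 * (theta q (A / x2) / theta q x2)
      * (theta q (A / x3) / theta q x3) * (theta q (A / x4) / theta q x4)"

text \<open>
  By quasi-periodicity each quotient picks up the factor \<open>A / x\<^sub>i\<^sup>2\<close> under a shift by \<open>q\<close>, and the
  product of the four factors is \<open>1\<close>.
\<close>
lemma theta_quotient_shift:
  assumes q: "nome q"
    and nz: "x1 \<noteq> 0" "x2 \<noteq> 0" "x3 \<noteq> 0" "x4 \<noteq> 0" "A \<noteq> 0" and A: "x1 * x2 * x3 * x4 = A\<^sup>2"
  shows "theta q (A / x1 / q ^ n) / theta q (x1 / q ^ n) * (theta q (A / x2 / q ^ n) / theta q (x2 / q ^ n))
      * (theta q (A / x3 / q ^ n) / theta q (x3 / q ^ n)) * (theta q (A / x4 / q ^ n) / theta q (x4 / q ^ n))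
    = theta_quotient q A x1 x2 x3 x4"
proof (induction n)
  case 0
  show ?case by (simp add: theta_quotient_def)
next
  case (Suc n)
  have step: "theta q (A / x / q ^ Suc n) / theta q (x / q ^ Suc n)
      = A / x\<^sup>2 * (theta q (A / x / q ^ n) / theta q (x / q ^ n))" if "x \<noteq> 0" for x
  proof -
    have "theta q (A / x / q ^ Suc n) = - (A / x / q ^ n / q) * theta q (A / x / q ^ n)"
      using theta_div_q[OF q, of "A / x / q ^ n"] that nz(5) q_nonzero[OF q] by (simp add: mult_ac)
    moreover have "theta q (x / q ^ Suc n) = - (x / q ^ n / q) * theta q (x / q ^ n)"
      using theta_div_q[OF q, of "x / q ^ n"] that q_nonzero[OF q] by (simp add: mult.commute)
    ultimately show ?thesis
      using that q_nonzero[OF q] by (simp add: power2_eq_square)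
  qed
  have "A / x1\<^sup>2 * (A / x2\<^sup>2) * (A / x3\<^sup>2) * (A / x4\<^sup>2) = (A\<^sup>2)\<^sup>2 / (x1 * x2 * x3 * x4)\<^sup>2"
    by (simp add: power2_eq_square mult_ac)
  also have "\<dots> = 1" unfolding A using nz by simp
  finally have one: "A / x1\<^sup>2 * (A / x2\<^sup>2) * (A / x3\<^sup>2) * (A / x4\<^sup>2) = 1" .
  show ?case
    unfolding Suc.IH[symmetric] step[OF nz(1)] step[OF nz(2)] step[OF nz(3)] step[OF nz(4)]
    using arg_cong[OF one, of "\<lambda>z. z * (theta q (A / x1 / q ^ n) / theta q (x1 / q ^ n) * (theta q (A / x2 / q ^ n) / theta q (x2 / q ^ n))
      * (theta q (A / x3 / q ^ n) / theta q (x3 / q ^ n)) * (theta q (A / x4 / q ^ n) / theta q (x4 / q ^ n)))"]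
    by (simp only: mult_ac mult_1_left mult_1_right)
qed

text \<open>
  For arguments that grow like \<open>q\<^sup>-\<^sup>n\<close> the symbol is traded for a theta function, which is controlled
  by quasi-periodicity, and a symbol with a small argument.
\<close>
lemma poch_div_power:
  assumes q: "nome q"
    and "y \<noteq> 0" "theta q y \<noteq> 0"
  shows "poch q (y / q ^ n) = theta q (y / q ^ n) / poch q (q ^ Suc n / y)" "poch q (q ^ Suc n / y) \<noteq> 0"
proof -
  have *: "q / (y / q ^ n) = q ^ Suc n / y" by simp
  have "theta q (1 / y) \<noteq> 0" using theta_inverse[OF q, of y] assms by simp
  then show nz: "poch q (q ^ Suc n / y) \<noteq> 0"
    using poch_powi_nonzero[OF q, of "1 / y" "int (Suc n)"] assms
    by (simp only: power_int_of_nat) simp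
  then show "poch q (y / q ^ n) = theta q (y / q ^ n) / poch q (q ^ Suc n / y)"
    unfolding theta_def[of q "y / q ^ n"] * by simp
qed

text \<open>
  Very-well-poised symmetry: reversing the direction of summation gives a series of the same kind with
  the parameters \<open>1 / A\<close> and \<open>x\<^sub>i / A\<close>.  Estimates are thus needed only for nonnegative indices.
\<close>
lemma vwp_term_reflect:
  assumes q: "nome q"
    and reg: "regular q A x1" "regular q A x2" "regular q A x3" "regular q A x4" and "A \<noteq> 0"
    and A: "x1 * x2 * x3 * x4 = A\<^sup>2"
  shows "vwp_term q A x1 x2 x3 x4 (- int k) =
    - (theta_quotient q A x1 x2 x3 x4 / A) * vwp_term q (1 / A) (x1 / A) (x2 / A) (x3 / A) (x4 / A) (int k)"
proof -
  have ratio: "poch_ratio q A x (- int k) =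
      - (x * q ^ k / A) * (theta q (A / x / q ^ k) / theta q (x / q ^ k)) * poch_ratio q (1 / A) (x / A) (int k)"
    if "regular q A x" for x
  proof -
    have x: "x \<noteq> 0" "theta q x \<noteq> 0" "A / x \<noteq> 0" "theta q (A / x) \<noteq> 0"
      using that \<open>A \<noteq> 0\<close> by (auto simp: regular_def)
    define y where "y = A / x / q ^ k"
    have y: "y \<noteq> 0" using x q_nonzero[OF q] by (simp add: y_def)
    have 1: "poch q y = theta q y / poch q (q ^ Suc k * x / A)"
      using poch_div_power[OF q x(3,4), of k] by (simp add: y_def)
    have n: "poch q (q ^ Suc k * x / A) \<noteq> 0"
      using poch_div_power(2)[OF q x(3,4), of k] by simp
    have 2: "poch q (q ^ k * x / A) = (1 - 1 / y) * poch q (q ^ Suc k * x / A)"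
      using poch_step[OF q, of "q ^ k * x / A"] by (simp add: y_def mult_ac)
    have m: "poch q (q ^ k * x / A) \<noteq> 0"
    proof -
      have "theta q (x / A) \<noteq> 0" using theta_inverse[OF q x(3)] x by simp
      then show ?thesis using poch_powi_nonzero[OF q, of "x / A" "int k"] x \<open>A \<noteq> 0\<close> by (simp add: mult_ac)
    qed
    then have y1: "1 - 1 / y \<noteq> 0" using 2 by auto
    have 3: "poch q y = (1 - y) * poch q (y * q)" by (rule poch_step[OF q])
    have numerator: "poch q (y * q) = - (1 / y) * theta q y / poch q (q ^ k * x / A)"
    proof -
      have neg: "1 - 1 / y = - (1 - y) / y" using y by (simp add: field_simps)
      have "1 - y \<noteq> 0" using y1 y by auto
      with 1 3 have "poch q (y * q) = theta q y / poch q (q ^ Suc k * x / A) / (1 - y)"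
        by (metis nonzero_mult_div_cancel_left)
      also have "\<dots> = - (1 / y) * theta q y / poch q (q ^ k * x / A)"
        unfolding 2 neg using y \<open>1 - y \<noteq> 0\<close> n by (simp del: minus_diff_eq)
      finally show ?thesis .
    qed
    have arguments: "A / x * q powi (- int k + 1) = y * q" "x * q powi (- int k) = x / q ^ k"
      "1 / A / (x / A) * q powi (int k + 1) = q ^ Suc k / x" "x / A * q powi (int k) = q ^ k * x / A"
      "x * q ^ k / A = 1 / y"
      using q_nonzero[OF q] \<open>A \<noteq> 0\<close> x
      by (simp_all add: y_def power_int_add power_int_diff power_int_minus field_simps)
    show ?thesis
      unfolding poch_ratio_def arguments numerator poch_div_power(1)[OF q x(1,2)] y_def[symmetric]
      by simp
  qed
  have nz: "x1 \<noteq> 0" "x2 \<noteq> 0" "x3 \<noteq> 0" "x4 \<noteq> 0" using reg by (auto simp: regular_def)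
  let ?T = "\<lambda>x. theta q (A / x / q ^ k) / theta q (x / q ^ k)"
  let ?R = "\<lambda>x. poch_ratio q (1 / A) (x / A) (int k)"
  have "vwp_term q A x1 x2 x3 x4 (- int k) = q powi (- int k) * (1 - A * q powi (2 * - int k)) *
      ((x1 * q ^ k / A) * (x2 * q ^ k / A) * (x3 * q ^ k / A) * (x4 * q ^ k / A)) *
      (?T x1 * ?T x2 * ?T x3 * ?T x4) * (?R x1 * ?R x2 * ?R x3 * ?R x4)"
    unfolding vwp_term_def ratio[OF reg(1)] ratio[OF reg(2)] ratio[OF reg(3)] ratio[OF reg(4)]
    by (simp only: mult_ac minus_mult_minus mult_minus_left mult_minus_right minus_minus)
  also have "?T x1 * ?T x2 * ?T x3 * ?T x4 = theta_quotient q A x1 x2 x3 x4"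
    by (rule theta_quotient_shift[OF q nz \<open>A \<noteq> 0\<close> A])
  also have "(x1 * q ^ k / A) * (x2 * q ^ k / A) * (x3 * q ^ k / A) * (x4 * q ^ k / A)
      = (x1 * x2 * x3 * x4) * (q ^ k) ^ 4 / A ^ 4"
    by (simp add: power4_eq_xxxx)
  also have "\<dots> = (q ^ k) ^ 4 / A\<^sup>2"
    unfolding A using \<open>A \<noteq> 0\<close> by (simp add: power4_eq_xxxx power2_eq_square)
  also have "q powi (- int k) * (1 - A * q powi (2 * - int k)) * ((q ^ k) ^ 4 / A\<^sup>2)
      = - (1 / A) * (q powi (int k) * (1 - 1 / A * q powi (2 * int k)))"
  proof -
    have powers: "q powi (2 * int k) = (q ^ k)\<^sup>2" "q powi (int k) = q ^ k" "q powi (- int k) = 1 / q ^ k"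
      "q powi (2 * - int k) = 1 / (q ^ k)\<^sup>2"
      by (simp_all add: power_int_mult power_int_minus field_simps flip: power_mult)
    show ?thesis
      unfolding powers using q_nonzero[OF q] \<open>A \<noteq> 0\<close> by (simp add: power4_eq_xxxx power2_eq_square field_simps)
  qed
  finally show ?thesis
    unfolding vwp_term_def by (simp add: mult_ac)
qed

lemma regular_swap:
  assumes q: "nome q"
    and "regular q A x" "A \<noteq> 0"
  shows "x / A \<noteq> 0" "theta q (x / A) \<noteq> 0"
  using assms theta_inverse[OF q, of "A / x"] by (auto simp: regular_def)

lemma vwp_bound:
  fixes x1 x2 x3 x4 :: "nat \<Rightarrow> complex"
  assumes q: "nome q"
    and lim: "x1 \<longlonglongrightarrow> X1" "x2 \<longlonglongrightarrow> X2" "x3 \<longlonglongrightarrow> X3" "x4 \<longlonglongrightarrow> X4"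
    and X: "regular q A X1" "regular q A X2" "regular q A X3" "regular q A X4"
    and x: "\<And>m. regular q A (x1 m)" "\<And>m. regular q A (x2 m)" "\<And>m. regular q A (x3 m)" "\<And>m. regular q A (x4 m)"
    and "A \<noteq> 0" and A: "\<And>m. x1 m * x2 m * x3 m * x4 m = A\<^sup>2"
  shows "\<exists>B. \<forall>m k. norm (vwp_term q A (x1 m) (x2 m) (x3 m) (x4 m) k) \<le> B * norm q ^ nat \<bar>k\<bar>"
proof -
  note reg_nz = X[unfolded regular_def] x[unfolded regular_def]
  obtain B1 where B1: "norm (vwp_term q A (x1 m) (x2 m) (x3 m) (x4 m) (int k)) \<le> B1 * norm q ^ k" for m k
    using vwp_forward_bound[OF q lim, of A] reg_nz by blast
  have "\<exists>B. \<forall>m k. norm (vwp_term q (1 / A) (x1 m / A) (x2 m / A) (x3 m / A) (x4 m / A) (int k)) \<le> B * norm q ^ k"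
  proof (rule vwp_forward_bound[OF q])
    show "(\<lambda>m. x1 m / A) \<longlonglongrightarrow> X1 / A" "(\<lambda>m. x2 m / A) \<longlonglongrightarrow> X2 / A"
      "(\<lambda>m. x3 m / A) \<longlonglongrightarrow> X3 / A" "(\<lambda>m. x4 m / A) \<longlonglongrightarrow> X4 / A"
      by (intro tendsto_divide lim tendsto_const \<open>A \<noteq> 0\<close>)+
  qed (rule regular_swap[OF q _ \<open>A \<noteq> 0\<close>], rule X x)+
  then obtain B2 where B2:
    "norm (vwp_term q (1 / A) (x1 m / A) (x2 m / A) (x3 m / A) (x4 m / A) (int k)) \<le> B2 * norm q ^ k" for m k
    by blast
  have "(\<lambda>m. theta q (A / y m) / theta q (y m)) \<longlonglongrightarrow> theta q (A / Y) / theta q Y"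
    if "y \<longlonglongrightarrow> Y" "regular q A Y" for y Y
    using that \<open>A \<noteq> 0\<close>
    by (intro tendsto_divide tendsto_theta[OF q] tendsto_const) (auto simp: regular_def)
  note quotient = this[OF lim(1) X(1)] this[OF lim(2) X(2)] this[OF lim(3) X(3)] this[OF lim(4) X(4)]
  have "(\<lambda>m. theta_quotient q A (x1 m) (x2 m) (x3 m) (x4 m)) \<longlonglongrightarrow> theta_quotient q A X1 X2 X3 X4"
    unfolding theta_quotient_def by (intro tendsto_mult quotient)
  then have "Bseq (\<lambda>m. theta_quotient q A (x1 m) (x2 m) (x3 m) (x4 m))"
    using convergentI convergent_imp_Bseq by blast
  then obtain R where R: "norm (theta_quotient q A (x1 m) (x2 m) (x3 m) (x4 m)) \<le> R" for m
    by (auto simp: Bseq_def)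
  have B1': "0 \<le> B1" using order_trans[OF norm_ge_zero B1[of 0 0]] by simp
  have B2': "0 \<le> B2" using order_trans[OF norm_ge_zero B2[of 0 0]] by simp
  have R': "0 \<le> R" using order_trans[OF norm_ge_zero R[of 0]] .
  have "norm (vwp_term q A (x1 m) (x2 m) (x3 m) (x4 m) k) \<le> (B1 + R / norm A * B2) * norm q ^ nat \<bar>k\<bar>" for m k
  proof (cases "k \<ge> 0")
    case True
    have "norm (vwp_term q A (x1 m) (x2 m) (x3 m) (x4 m) k) \<le> B1 * norm q ^ nat \<bar>k\<bar>"
      using B1[of m "nat k"] True by simp
    also have "\<dots> \<le> (B1 + R / norm A * B2) * norm q ^ nat \<bar>k\<bar>"
      using R' B2' by (intro mult_right_mono) auto
    finally show ?thesis .
  next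
    case False
    define j where "j = nat (- k)"
    have k: "k = - int j" "nat \<bar>k\<bar> = j" using False by (simp_all add: j_def)
    have "norm (vwp_term q A (x1 m) (x2 m) (x3 m) (x4 m) k)
        = norm (theta_quotient q A (x1 m) (x2 m) (x3 m) (x4 m)) / norm A
          * norm (vwp_term q (1 / A) (x1 m / A) (x2 m / A) (x3 m / A) (x4 m / A) (int j))"
      unfolding k(1) vwp_term_reflect[OF q x \<open>A \<noteq> 0\<close> A] by (simp add: norm_mult norm_divide)
    also have "\<dots> \<le> R / norm A * (B2 * norm q ^ j)"
      using R R' B2 by (intro mult_mono divide_right_mono) auto
    also have "\<dots> \<le> (B1 + R / norm A * B2) * norm q ^ nat \<bar>k\<bar>"
      unfolding k(2) using B1' by (simp add: distrib_right mult.assoc)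
    finally show ?thesis .
  qed
  then show ?thesis by blast
qed

lemma summable_geometric_int:
  assumes q: "nome q"
  shows "summable (\<lambda>n. B * norm q ^ nat \<bar>int n\<bar>)" "summable (\<lambda>n. B * norm q ^ nat \<bar>- int n - 1\<bar>)"
proof -
  have *: "nat \<bar>- int n - 1\<bar> = Suc n" for n by simp
  show "summable (\<lambda>n. B * norm q ^ nat \<bar>int n\<bar>)" "summable (\<lambda>n. B * norm q ^ nat \<bar>- int n - 1\<bar>)"
    unfolding * using norm_q[OF q] summable_geometric[of "norm q"]
    by (auto intro!: summable_mult)
qed

lemma vwp_summable:
  assumes q: "nome q"
    and reg: "regular q A x1" "regular q A x2" "regular q A x3" "regular q A x4" and "A \<noteq> 0"
    and A: "x1 * x2 * x3 * x4 = A\<^sup>2"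
  shows "summable (\<lambda>n. norm (vwp_term q A x1 x2 x3 x4 (int n)))"
    and "summable (\<lambda>n. norm (vwp_term q A x1 x2 x3 x4 (- int n - 1)))"
proof -
  obtain B where B: "norm (vwp_term q A x1 x2 x3 x4 k) \<le> B * norm q ^ nat \<bar>k\<bar>" for k
    using vwp_bound[OF q, of "\<lambda>_. x1" x1 "\<lambda>_. x2" x2 "\<lambda>_. x3" x3 "\<lambda>_. x4" x4 A] assms by auto
  show "summable (\<lambda>n. norm (vwp_term q A x1 x2 x3 x4 (int n)))"
    by (rule summable_comparison_test'[OF summable_geometric_int(1)[OF q, of B], of 0])
      (use B[of "int _"] in simp)
  show "summable (\<lambda>n. norm (vwp_term q A x1 x2 x3 x4 (- int n - 1)))"
    by (rule summable_comparison_test'[OF summable_geometric_int(2)[OF q, of B], of 0])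
      (use B[of "- int _ - 1"] in simp)
qed

definition antidifference :: "complex \<Rightarrow> complex \<Rightarrow> complex \<Rightarrow> complex \<Rightarrow> complex \<Rightarrow> complex \<Rightarrow> int \<Rightarrow> complex" where
  "antidifference q A x1 x2 x3 x4 k =
     poch q (A / x1 * q powi (k + 1)) / poch q (x1 * q powi (k + 1)) *
     (poch q (A / x2 * q powi (k + 1)) / poch q (x2 * q powi (k + 1))) *
     (poch q (A / x3 * q powi (k + 1)) / poch q (x3 * q powi (k + 1))) *
     (poch q (A / x4 * q powi (k + 1)) / poch q (x4 * q powi (k + 1)))"

text \<open>
  With the common factor \<open>\<Prod> (A q\<^bsup>k+1\<^esup> / x\<^sub>i)\<^sub>\<infinity> / (x\<^sub>i q\<^sup>k)\<^sub>\<infinity>\<close> taken out, the two antidifferences are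
  the two products in \<open>telescoping_algebra\<close> at \<open>z = q\<^sup>k\<close>.
\<close>
lemma antidifference_step:
  assumes q: "nome q"
    and reg: "regular q A x1" "regular q A x2" "regular q A x3" "regular q A x4" and "A \<noteq> 0"
    and A: "x1 * x2 * x3 * x4 = A\<^sup>2"
  shows "antidifference q A x1 x2 x3 x4 k - antidifference q A x1 x2 x3 x4 (k - 1) =
    A / x1 * (1 - x1 * x2 / A) * (1 - x1 * x3 / A) * (1 - x1 * x4 / A) * vwp_term q A x1 x2 x3 x4 k"
proof -
  define z where "z = q powi k"
  have z: "q powi (k + 1) = z * q" "q powi (k - 1 + 1) = z" "q powi (2 * k) = z\<^sup>2"
    using q_nonzero[OF q] by (simp_all add: z_def power_int_add power_int_mult mult.commute[of 2])
  have nz: "x1 \<noteq> 0" "x2 \<noteq> 0" "x3 \<noteq> 0" "x4 \<noteq> 0" using reg by (auto simp: regular_def)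
  have x4: "x4 = A\<^sup>2 / (x1 * x2 * x3)" using A nz by (simp add: field_simps)
  have ratios: "poch q (A / x * (z * q)) / poch q (x * (z * q)) = (1 - x * z) * poch_ratio q A x k"
    "poch q (A / x * z) / poch q (x * z) = (1 - A / x * z) * poch_ratio q A x k" if "regular q A x" for x
  proof -
    have "poch q (x * z) \<noteq> 0"
      unfolding z_def using that by (intro poch_powi_nonzero[OF q]) (auto simp: regular_def)
    then show "poch q (A / x * (z * q)) / poch q (x * (z * q)) = (1 - x * z) * poch_ratio q A x k"
      "poch q (A / x * z) / poch q (x * z) = (1 - A / x * z) * poch_ratio q A x k"
      using poch_step[OF q, of "x * z"] poch_step[OF q, of "A / x * z"]
      unfolding poch_ratio_def z z_def[symmetric] by (auto simp: mult.assoc)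
  qed
  define r where "r = poch_ratio q A x1 k * poch_ratio q A x2 k * poch_ratio q A x3 k * poch_ratio q A x4 k"
  have "antidifference q A x1 x2 x3 x4 k = (1 - x1 * z) * (1 - x2 * z) * (1 - x3 * z) * (1 - x4 * z) * r"
    unfolding antidifference_def z r_def ratios[OF reg(1)] ratios[OF reg(2)] ratios[OF reg(3)] ratios[OF reg(4)]
    by (simp only: mult_ac)
  moreover have "antidifference q A x1 x2 x3 x4 (k - 1)
      = (1 - A / x1 * z) * (1 - A / x2 * z) * (1 - A / x3 * z) * (1 - A / x4 * z) * r"
    unfolding antidifference_def z r_def ratios[OF reg(1)] ratios[OF reg(2)] ratios[OF reg(3)] ratios[OF reg(4)]
    by (simp only: mult_ac)
  moreover have "vwp_term q A x1 x2 x3 x4 k = (z * (1 - A * z\<^sup>2)) * r"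
    by (simp add: vwp_term_def r_def z flip: z_def)
  ultimately show ?thesis
    using telescoping_algebra[OF nz(1,2,3) \<open>A \<noteq> 0\<close> x4, of z]
    by (simp only: left_diff_distrib[symmetric] mult.assoc[symmetric])
qed

lemma antidifference_at_top:
  assumes q: "nome q"
  shows "(\<lambda>n. antidifference q A x1 x2 x3 x4 (int n + c)) \<longlonglongrightarrow> 1"
proof -
  have factor: "(\<lambda>n. poch q (a * q powi (int n + c + 1))) \<longlonglongrightarrow> 1" for a
    using tendsto_poch[OF q tendsto_mult[OF tendsto_const[of a] tendsto_powi_q[OF q, of "c + 1"]]]
    by (simp add: poch_0 add.assoc)
  have "(\<lambda>n. antidifference q A x1 x2 x3 x4 (int n + c))
      \<longlonglongrightarrow> 1 / 1 * (1 / 1) * (1 / 1) * (1 / 1)"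
    unfolding antidifference_def by (intro tendsto_mult tendsto_divide factor) auto
  then show ?thesis by simp
qed

lemma antidifference_at_bot:
  assumes q: "nome q"
    and reg: "regular q A x1" "regular q A x2" "regular q A x3" "regular q A x4" and "A \<noteq> 0"
    and A: "x1 * x2 * x3 * x4 = A\<^sup>2"
  shows "(\<lambda>n. antidifference q A x1 x2 x3 x4 (- int n - 1)) \<longlonglongrightarrow> theta_quotient q A x1 x2 x3 x4"
proof -
  have nz: "x1 \<noteq> 0" "x2 \<noteq> 0" "x3 \<noteq> 0" "x4 \<noteq> 0" using reg by (auto simp: regular_def)
  let ?c = "\<lambda>n x. poch q (q ^ Suc n / x) / poch q (q ^ Suc n / (A / x))"
  have ratio: "poch q (A / x * q powi (- int n - 1 + 1)) / poch q (x * q powi (- int n - 1 + 1))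
      = theta q (A / x / q ^ n) / theta q (x / q ^ n) * ?c n x" if "regular q A x" for x n
  proof -
    have "y * q powi (- int n - 1 + 1) = y / q ^ n" for y
      by (simp add: power_int_minus field_simps)
    moreover have "x \<noteq> 0" "theta q x \<noteq> 0" "A / x \<noteq> 0" "theta q (A / x) \<noteq> 0"
      using that \<open>A \<noteq> 0\<close> by (auto simp: regular_def)
    ultimately show ?thesis
      using poch_div_power[OF q, of x n] poch_div_power[OF q, of "A / x" n] by (simp only:) simp
  qed
  have "antidifference q A x1 x2 x3 x4 (- int n - 1)
      = theta_quotient q A x1 x2 x3 x4 * (?c n x1 * ?c n x2 * ?c n x3 * ?c n x4)" for n
    unfolding antidifference_def ratio[OF reg(1)] ratio[OF reg(2)] ratio[OF reg(3)] ratio[OF reg(4)]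
      theta_quotient_shift[OF q nz \<open>A \<noteq> 0\<close> A, of n, symmetric]
    by (simp only: mult_ac)
  moreover have factor: "(\<lambda>n. poch q (q ^ Suc n / y)) \<longlonglongrightarrow> 1" for y
    using tendsto_poch[OF q tendsto_divide_zero[OF LIMSEQ_Suc[OF tendsto_power_q[OF q]], of y]]
    by (simp only: poch_0)
  then have "(\<lambda>n. ?c n x) \<longlonglongrightarrow> 1 / 1" for x
    by (intro tendsto_divide factor) auto
  then have "(\<lambda>n. theta_quotient q A x1 x2 x3 x4 * (?c n x1 * ?c n x2 * ?c n x3 * ?c n x4))
      \<longlonglongrightarrow> theta_quotient q A x1 x2 x3 x4 * (1 / 1 * (1 / 1) * (1 / 1) * (1 / 1))"
    by (intro tendsto_mult tendsto_const) auto
  ultimately show ?thesis by simp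
qed

text \<open>
  The telescoped sum is \<open>1 - \<Prod> \<theta>(A/x\<^sub>i) / \<theta>(x\<^sub>i)\<close> divided by \<open>C\<close>; the addition formula exhibits the same
  \<open>C\<close> as a factor of the numerator.
\<close>
lemma vwp_sum_generic:
  assumes q: "nome q"
    and reg: "regular q A x1" "regular q A x2" "regular q A x3" "regular q A x4" and "A \<noteq> 0"
    and A: "x1 * x2 * x3 * x4 = A\<^sup>2"
    and ne: "x1 * x2 \<noteq> A" "x1 * x3 \<noteq> A" "x1 * x4 \<noteq> A"
  shows "(\<Sum>\<^sub>\<infinity>k. vwp_term q A x1 x2 x3 x4 k)
     = theta q A * theta_red q (x1 * x2 / A) * theta_red q (x1 * x3 / A) * theta_red q (x1 * x4 / A)
       / (theta q x1 * theta q x2 * theta q x3 * theta q x4)"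
proof -
  define C where "C = A / x1 * (1 - x1 * x2 / A) * (1 - x1 * x3 / A) * (1 - x1 * x4 / A)"
  let ?V = "antidifference q A x1 x2 x3 x4" and ?t = "vwp_term q A x1 x2 x3 x4"
  have nz: "x1 \<noteq> 0" "x2 \<noteq> 0" "x3 \<noteq> 0" "x4 \<noteq> 0" using reg by (auto simp: regular_def)
  have theta_nz: "theta q x1 \<noteq> 0" "theta q x2 \<noteq> 0" "theta q x3 \<noteq> 0" "theta q x4 \<noteq> 0"
    using reg by (auto simp: regular_def)
  have "1 - u / A \<noteq> 0" if "u \<noteq> A" for u using that \<open>A \<noteq> 0\<close> by simp
  then have C: "C \<noteq> 0" using nz ne \<open>A \<noteq> 0\<close> by (simp add: C_def)
  have step: "C * ?t k = ?V k - ?V (k - 1)" for k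
    using antidifference_step[OF q reg \<open>A \<noteq> 0\<close> A, of k] by (simp add: C_def)
  have "(\<lambda>n. C * ?t (int n)) sums (1 - ?V (- 1))"
    using telescope_sums[OF antidifference_at_top[OF q, where c = "- 1"]]
    by (simp add: step)
  from sums_divide[OF this, of C] have forward: "(\<lambda>n. ?t (int n)) sums ((1 - ?V (- 1)) / C)"
    using C by simp
  have "- int (Suc n) - 1 = - int n - 1 - 1" for n by simp
  then have "(\<lambda>n. C * ?t (- int n - 1)) sums (?V (- 1) - theta_quotient q A x1 x2 x3 x4)"
    using telescope_sums'[OF antidifference_at_bot[OF q reg \<open>A \<noteq> 0\<close> A]] by (simp only: step) simp
  from sums_divide[OF this, of C]
  have backward: "(\<lambda>n. ?t (- int n - 1)) sums ((?V (- 1) - theta_quotient q A x1 x2 x3 x4) / C)"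
    using C by simp
  have "(?t has_sum (1 - ?V (- 1)) / C + (?V (- 1) - theta_quotient q A x1 x2 x3 x4) / C) UNIV"
    using has_sum_int_split[OF vwp_summable[OF q reg \<open>A \<noteq> 0\<close> A]]
    unfolding sums_unique[OF forward] sums_unique[OF backward] .
  then have "(\<Sum>\<^sub>\<infinity>k. ?t k) = (1 - theta_quotient q A x1 x2 x3 x4) / C"
    by (simp add: infsumI flip: add_divide_distrib)
  also have "1 - theta_quotient q A x1 x2 x3 x4
      = (theta q x1 * theta q x2 * theta q x3 * theta q x4
         - theta q (A / x1) * theta q (A / x2) * theta q (A / x3) * theta q (A / x4))
        / (theta q x1 * theta q x2 * theta q x3 * theta q x4)"
    using theta_nz by (simp add: theta_quotient_def diff_divide_distrib)
  also have "theta q x1 * theta q x2 * theta q x3 * theta q x4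
         - theta q (A / x1) * theta q (A / x2) * theta q (A / x3) * theta q (A / x4)
      = C * (theta q A * theta_red q (x1 * x2 / A) * theta_red q (x1 * x3 / A) * theta_red q (x1 * x4 / A))"
    unfolding theta_addition[OF q nz \<open>A \<noteq> 0\<close> A] theta_eq[OF q, of "x1 * x2 / A"] theta_eq[OF q, of "x1 * x3 / A"]
      theta_eq[OF q, of "x1 * x4 / A"] C_def by (simp only: mult_ac)
  finally show ?thesis using C by simp
qed

lemma tendsto_poch_ratio:
  assumes q: "nome q"
    and "regular q A X" "x \<longlonglongrightarrow> X"
  shows "(\<lambda>m. poch_ratio q A (x m) k) \<longlonglongrightarrow> poch_ratio q A X k"
  unfolding poch_ratio_def using assms poch_powi_nonzero[OF q, of X k]
  by (intro tendsto_intros limits[OF q]) (auto simp: regular_def)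

text \<open>
  Bailey's evaluation in the balanced case.  When \<open>x\<^sub>1 x\<^sub>2 = A\<close> or \<open>x\<^sub>1 x\<^sub>4 = A\<close> the telescoping degenerates
  to \<open>0 = 0\<close>.  Replacing \<open>x\<^sub>2\<close> by \<open>x\<^sub>2 / s\<close> and \<open>x\<^sub>4\<close> by \<open>x\<^sub>4 s\<close> keeps the product and the condition
  \<open>x\<^sub>1 x\<^sub>3 \<noteq> A\<close>, and makes the parameters generic for \<open>s \<noteq> 1\<close> close to \<open>1\<close>; both sides are
  continuous at \<open>s = 1\<close>.
\<close>
theorem vwp_sum:
  assumes q: "nome q"
    and reg: "regular q A x1" "regular q A x2" "regular q A x3" "regular q A x4" and "A \<noteq> 0"
    and A: "x1 * x2 * x3 * x4 = A\<^sup>2" and ne: "x1 * x3 \<noteq> A"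
  shows "(\<Sum>\<^sub>\<infinity>k. vwp_term q A x1 x2 x3 x4 k)
     = theta q A * theta_red q (x1 * x2 / A) * theta_red q (x1 * x3 / A) * theta_red q (x1 * x4 / A)
       / (theta q x1 * theta q x2 * theta q x3 * theta q x4)"
proof -
  have nz: "x1 \<noteq> 0" "x2 \<noteq> 0" "x3 \<noteq> 0" "x4 \<noteq> 0" using reg by (auto simp: regular_def)
  have theta_nz: "theta q x1 \<noteq> 0" "theta q x2 \<noteq> 0" "theta q x3 \<noteq> 0" "theta q x4 \<noteq> 0"
    using reg by (auto simp: regular_def)
  \<comment> \<open>Any sequence with limit \<open>1\<close> that avoids \<open>1\<close> serves; its first terms may be exceptional and are dropped.\<close>
  define s0 :: "nat \<Rightarrow> complex" where "s0 n = 1 + 1 / of_nat (Suc n)" for n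
  have s0: "s0 \<longlonglongrightarrow> 1"
    unfolding s0_def using tendsto_add[OF tendsto_const[of 1] lim_1_over_n[THEN LIMSEQ_Suc]] by simp
  have s0_at: "filterlim s0 (at 1) sequentially"
    by (rule filterlim_atI[OF s0]) (simp add: s0_def del: of_nat_Suc)
  have avoid: "eventually (\<lambda>n. s0 n \<noteq> c) sequentially" for c
    by (rule eventually_compose_filterlim[OF eventually_neq_at_within s0_at])
  have regular_ev: "eventually (\<lambda>n. regular q A (f n)) sequentially" if "f \<longlonglongrightarrow> X" "regular q A X" for f X
  proof -
    have "(\<lambda>n. theta q (f n)) \<longlonglongrightarrow> theta q X" "(\<lambda>n. theta q (A / f n)) \<longlonglongrightarrow> theta q (A / X)"
      using that \<open>A \<noteq> 0\<close> by (auto intro!: tendsto_intros limits[OF q] simp: regular_def)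
    then have "eventually (\<lambda>n. theta q (f n) \<noteq> 0) sequentially" "eventually (\<lambda>n. theta q (A / f n) \<noteq> 0) sequentially"
      "eventually (\<lambda>n. f n \<noteq> 0) sequentially"
      using that by (auto intro!: tendsto_imp_eventually_ne simp: regular_def)
    then show ?thesis by eventually_elim (simp add: regular_def)
  qed
  have "(\<lambda>n. x2 / s0 n) \<longlonglongrightarrow> x2" "(\<lambda>n. x4 * s0 n) \<longlonglongrightarrow> x4"
    using tendsto_divide[OF tendsto_const s0, of x2] tendsto_mult[OF tendsto_const s0, of x4] by simp_all
  then have "eventually (\<lambda>n. regular q A (x2 / s0 n) \<and> regular q A (x4 * s0 n) \<and> s0 n \<noteq> 0
      \<and> s0 n \<noteq> x1 * x2 / A \<and> s0 n \<noteq> A / (x1 * x4)) sequentially"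
    by (intro eventually_conj avoid regular_ev[OF _ reg(2)] regular_ev[OF _ reg(4)])
  then obtain N where N: "regular q A (x2 / s0 n)" "regular q A (x4 * s0 n)" "s0 n \<noteq> 0"
      "s0 n \<noteq> x1 * x2 / A" "s0 n \<noteq> A / (x1 * x4)" if "n \<ge> N" for n
    unfolding eventually_at_top_linorder by blast
  define s where "s n = s0 (n + N)" for n
  have s: "s \<longlonglongrightarrow> 1" unfolding s_def by (rule LIMSEQ_ignore_initial_segment[OF s0])
  have s_nz: "s n \<noteq> 0" for n using N(3)[of "n + N"] by (simp add: s_def)
  have reg_s: "regular q A (x2 / s n)" "regular q A (x4 * s n)" for n
    using N(1,2)[of "n + N"] by (simp_all add: s_def)
  have ne2: "x1 * (x2 / s n) \<noteq> A" and ne4: "x1 * (x4 * s n) \<noteq> A" for n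
    using N(3-5)[of "n + N"] nz \<open>A \<noteq> 0\<close> by (auto simp: s_def field_simps)
  have As: "x1 * (x2 / s n) * x3 * (x4 * s n) = A\<^sup>2" for n
    using A s_nz[of n] by (simp add: mult.assoc)
  have lim2: "(\<lambda>n. x2 / s n) \<longlonglongrightarrow> x2" and lim4: "(\<lambda>n. x4 * s n) \<longlonglongrightarrow> x4"
    using tendsto_divide[OF tendsto_const s, of x2] tendsto_mult[OF tendsto_const s, of x4] by simp_all
  obtain B where B: "norm (vwp_term q A x1 (x2 / s n) x3 (x4 * s n) k) \<le> B * norm q ^ nat \<bar>k\<bar>" for n k
    using vwp_bound[OF q tendsto_const[of x1] lim2 tendsto_const[of x3] lim4 reg reg(1) reg_s(1) reg(3) reg_s(2) \<open>A \<noteq> 0\<close> As]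
    by blast
  have "(\<lambda>n. \<Sum>\<^sub>\<infinity>k. vwp_term q A x1 (x2 / s n) x3 (x4 * s n) k) \<longlonglongrightarrow> (\<Sum>\<^sub>\<infinity>k. vwp_term q A x1 x2 x3 x4 k)"
  proof (rule infsum_int_dominated[OF _ B summable_geometric_int[OF q]])
    show "(\<lambda>n. vwp_term q A x1 (x2 / s n) x3 (x4 * s n) k) \<longlonglongrightarrow> vwp_term q A x1 x2 x3 x4 k" for k
      unfolding vwp_term_def using reg by (intro tendsto_mult tendsto_const tendsto_poch_ratio[OF q] lim2 lim4)
  qed
  moreover have "(\<lambda>n. \<Sum>\<^sub>\<infinity>k. vwp_term q A x1 (x2 / s n) x3 (x4 * s n) k)
      \<longlonglongrightarrow> theta q A * theta_red q (x1 * x2 / A) * theta_red q (x1 * x3 / A) * theta_red q (x1 * x4 / A)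
       / (theta q x1 * theta q x2 * theta q x3 * theta q x4)"
    unfolding vwp_sum_generic[OF q reg(1) reg_s(1) reg(3) reg_s(2) \<open>A \<noteq> 0\<close> As ne2 ne ne4]
  proof (intro tendsto_mult tendsto_divide tendsto_const)
    show "(\<lambda>n. theta q (x2 / s n)) \<longlonglongrightarrow> theta q x2" "(\<lambda>n. theta q (x4 * s n)) \<longlonglongrightarrow> theta q x4"
      by (rule tendsto_theta[OF q lim2 nz(2)], rule tendsto_theta[OF q lim4 nz(4)])
    have "(\<lambda>n. theta_red q (x1 * y n / A)) \<longlonglongrightarrow> theta_red q (x1 * Y / A)" if "y \<longlonglongrightarrow> Y" "Y \<noteq> 0" for y Y
      using that nz(1) \<open>A \<noteq> 0\<close> by (intro tendsto_theta_red[OF q] tendsto_divide tendsto_mult tendsto_const) simp_all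
    from this[OF lim2 nz(2)] this[OF lim4 nz(4)]
    show "(\<lambda>n. theta_red q (x1 * (x2 / s n) / A)) \<longlonglongrightarrow> theta_red q (x1 * x2 / A)"
      "(\<lambda>n. theta_red q (x1 * (x4 * s n) / A)) \<longlonglongrightarrow> theta_red q (x1 * x4 / A)" .
    show "theta q x1 * theta q x2 * theta q x3 * theta q x4 \<noteq> 0"
      using theta_nz by simp
  qed
  ultimately show ?thesis using LIMSEQ_unique by blast
qed

section \<open>Orthogonality of the two matrices\<close>

lemma theta_shift_nonzero:
  assumes q: "nome q"
    and "x \<noteq> 0" "\<And>m. x \<noteq> q powi m"
  shows "theta q (x * q powi k) \<noteq> 0"
proof
  assume "theta q (x * q powi k) = 0"
  then obtain m where "x * q powi k = q powi m"
    using theta_eq_0_iff[OF q, of "x * q powi k"] assms(2) q_nonzero[OF q] by auto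
  then have "x = q powi (m - k)" using q_nonzero[OF q] by (simp add: power_int_diff field_simps)
  then show False using assms(3) by blast
qed

text \<open>
  This is the vanishing of the off-diagonal entries.
\<close>
lemma theta_red_powi:
  assumes q: "nome q"
    and "m \<noteq> 0"
  shows "theta_red q (q powi m) = 0"
proof -
  have "theta_red q (q powi m) = poch q (q powi (m + 1)) * poch q (q powi (1 - m))"
    using q_nonzero[OF q] by (simp add: theta_red_def power_int_add power_int_diff)
  then show ?thesis
    using poch_powi_nonpos[OF q, of "m + 1"] poch_powi_nonpos[OF q, of "1 - m"] assms by (cases "m > 0") auto
qed

lemma theta_red_1: "theta_red q 1 = (poch q q)\<^sup>2"
  by (simp add: theta_red_def power2_eq_square)

lemma geometric_int:
  fixes h :: "int \<Rightarrow> complex"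
  assumes q: "nome q"
    and step: "\<And>n. h (n + 1) = q * h n"
  shows "h n = q powi n * h 0"
proof (induction n rule: int_induct[where k = 0])
  case (step1 i)
  then show ?case using step[of i] q_nonzero[OF q] by (simp add: power_int_add)
next
  case (step2 i)
  then show ?case using step[of "i - 1"] q_nonzero[OF q] by (simp add: power_int_diff)
qed simp

text \<open>
  The theta factors of the diagonal sum depend on \<open>n\<close> only through this quotient; quasi-periodicity
  leaves the single power \<open>q\<^sup>n\<close>, which the factor \<open>q\<^bsup>k-l\<^esup>\<close> of the second matrix cancels.
\<close>
lemma theta_ratio_shift:
  assumes q: "nome q"
    and nz: "a \<noteq> 0" "b \<noteq> 0" "c \<noteq> 0"
  shows "theta q (b * c / a * q powi (2 * n)) / (theta q (b * q powi n) * theta q (a / b * q powi (- n))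
        * theta q (c * q powi n) * theta q (a / c * q powi (- n)))
    = q powi n * (theta q (b * c / a) / (theta q b * theta q (a / b) * theta q c * theta q (a / c)))"
proof -
  define h where "h n = theta q (b * c / a * q powi (2 * n)) / (theta q (b * q powi n) * theta q (a / b * q powi (- n))
        * theta q (c * q powi n) * theta q (a / c * q powi (- n)))" for n
  have "h (n + 1) = q * h n" for n
  proof -
    define z where "z = q powi n"
    have z: "z \<noteq> 0" using q_nonzero[OF q] by (simp add: z_def)
    have powers: "q powi (2 * n) = z\<^sup>2" "q powi (2 * (n + 1)) = q * (q * z\<^sup>2)"
      "q powi (- n) = 1 / z" "q powi (- (n + 1)) = 1 / z / q" "q powi (n + 1) = q * z" "q powi n = z"
      unfolding z_def using q_nonzero[OF q]
      by (simp_all add: power_int_add power_int_minus power_int_diff power_int_mult distrib_left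
          power2_eq_square field_simps)
    have up: "theta q (x * (q * z)) = - theta q (x * z) / (x * z)" if "x \<noteq> 0" for x
      using theta_mult_q[OF q, of "x * z"] that z by (simp add: mult.left_commute)
    have down: "theta q (x * (1 / z / q)) = - (x / (z * q)) * theta q (x * (1 / z))" if "x \<noteq> 0" for x
      using theta_div_q[OF q, of "x / z"] that z by simp
    define y where "y = b * c / a * z\<^sup>2"
    have y: "y \<noteq> 0" using nz z by (simp add: y_def)
    have "theta q (b * c / a * (q * (q * z\<^sup>2))) = theta q (q * (q * y))"
      by (simp add: y_def mult.left_commute)
    also have "\<dots> = theta q y / (q * y\<^sup>2)"
      using theta_mult_q[OF q, of y] theta_mult_q[OF q, of "q * y"] y q_nonzero[OF q] by (simp add: power2_eq_square)
    finally have top: "theta q (b * c / a * (q * (q * z\<^sup>2))) = theta q y / (q * y\<^sup>2)" .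
    show ?thesis
      unfolding h_def powers top up[OF nz(2)] up[OF nz(3)] y_def[symmetric]
      using nz z q_nonzero[OF q] down[of "a / b"] down[of "a / c"]
      by (simp add: y_def power2_eq_square mult_ac)
  qed
  from geometric_int[OF q, of h, OF this] show ?thesis by (simp add: h_def)
qed

theorem theorem3p1:
  fixes q a b c :: complex
  assumes "0 < norm q" and "norm q < 1"
    and "a \<noteq> 0" and "b \<noteq> 0" and "c \<noteq> 0"
    and "\<And>m :: int. a \<noteq> q powi m"
    and "\<And>m :: int. b \<noteq> q powi m"
    and "\<And>m :: int. c \<noteq> q powi m"
    and "\<And>m :: int. a / b \<noteq> q powi m"
    and "\<And>m :: int. a / c \<noteq> q powi m"
    and "\<And>m :: int. b * c / a \<noteq> q powi m"
    and "\<And>m :: int. m \<noteq> 0 \<Longrightarrow> b / c \<noteq> q powi m"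
  shows "inverse_matrices (f_matrix q a b c) (g_matrix q a b c)"
proof -
  have q: "nome q" using assms(1,2) by (auto simp: nome_def)
  note nz = assms(3-5)
  have theta_nz: "theta q a \<noteq> 0" "theta q b \<noteq> 0" "theta q c \<noteq> 0" "theta q (a / b) \<noteq> 0" "theta q (a / c) \<noteq> 0"
    "theta q (b * c / a) \<noteq> 0"
    using theta_shift_nonzero[OF q _ assms(6), of 0] theta_shift_nonzero[OF q _ assms(7), of 0]
      theta_shift_nonzero[OF q _ assms(8), of 0] theta_shift_nonzero[OF q _ assms(9), of 0]
      theta_shift_nonzero[OF q _ assms(10), of 0] theta_shift_nonzero[OF q _ assms(11), of 0] nz by simp_all
  have bc_nz: "theta_red q (b / c) \<noteq> 0"
  proof
    assume "theta_red q (b / c) = 0"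
    then consider j where "b / c * q * q ^ j = 1" | j where "q / (b / c) * q ^ j = 1"
      by (auto simp: theta_red_def poch_eq_0_iff[OF q])
    then show False
    proof cases
      case 1
      then have "b / c = q powi (- int (Suc j))"
        unfolding power_int_minus power_int_of_nat using inverse_unique[of "q ^ Suc j" "b / c"]
        by (simp add: mult_ac)
      then show False using assms(12)[of "- int (Suc j)"] by simp
    next
      case 2
      then have "b / c = q powi int (Suc j)"
        unfolding power_int_of_nat using nz by (simp add: field_simps)
      then show False using assms(12)[of "int (Suc j)"] by simp
    qed
  qed
  have "(\<lambda>k. norm (f_matrix q a b c n k * g_matrix q a b c k l)) summable_on UNIV \<and>
      (\<Sum>\<^sub>\<infinity>k. f_matrix q a b c n k * g_matrix q a b c k l) = (if n = l then 1 else 0)" for n l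
  proof -
    define x1 where "x1 = b * q powi n"
    define x2 where "x2 = a / c * q powi (- n)"
    define x3 where "x3 = c * q powi l"
    define x4 where "x4 = a / b * q powi (- l)"
    let ?t = "vwp_term q a x1 x2 x3 x4"
    have quotients: "a / x1 = a / b * q powi (- n)" "a / x2 = c * q powi n" "a / x3 = a / c * q powi (- l)"
      "a / x4 = b * q powi l"
      using nz q_nonzero[OF q] by (simp_all add: x1_def x2_def x3_def x4_def power_int_minus field_simps)
    have reg: "regular q a x1" "regular q a x2" "regular q a x3" "regular q a x4"
      unfolding regular_def quotients
      using nz q_nonzero[OF q] theta_shift_nonzero[OF q _ assms(7)] theta_shift_nonzero[OF q _ assms(8)]
        theta_shift_nonzero[OF q _ assms(9)] theta_shift_nonzero[OF q _ assms(10)]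
      by (auto simp: x1_def x2_def x3_def x4_def)
    have prod: "x1 * x2 * x3 * x4 = a\<^sup>2"
      using nz q_nonzero[OF q] by (simp add: x1_def x2_def x3_def x4_def power_int_minus power2_eq_square)
    have pairs: "x1 * x2 / a = b / c" "x1 * x3 / a = b * c / a * q powi (n + l)" "x1 * x4 / a = q powi (n - l)"
      using nz q_nonzero[OF q]
      by (simp_all add: x1_def x2_def x3_def x4_def power_int_minus power_int_add power_int_diff field_simps)
    \<comment> \<open>The one pair that stays nondegenerate on the diagonal and for \<open>b = c\<close>.\<close>
    have ne: "x1 * x3 \<noteq> a"
    proof
      assume "x1 * x3 = a"
      then have "b * c / a * q powi (n + l) = 1" using pairs(2) nz by simp
      then have "b * c / a = q powi (- (n + l))"
        unfolding power_int_minus using inverse_unique[of "q powi (n + l)" "b * c / a"] by (simp add: mult.commute)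
      then show False using assms(11) by blast
    qed
    define Y where "Y = b * c / a * q powi (2 * n)"
    \<comment> \<open>The prefactors of both matrices combine into theta functions; the missing first
      factors such as \<open>1 - b\<close> come from \<open>(b)\<^sub>\<infinity> / (b q)\<^sub>\<infinity>\<close>.\<close>
    define K where "K = theta q b * theta q c * theta q (a / b) * theta q (a / c) * (1 - Y) * q powi (- l)
        / ((poch q q)\<^sup>2 * theta q a * theta q (b * c / a) * theta_red q (b / c))"
    have entry: "f_matrix q a b c n k * g_matrix q a b c k l = K * ?t k" for k
    proof -
      have split: "qpoch y q m = poch q y / poch q (y * q powi m)" for y m by (simp add: qpoch_def)
      have args: "b * q powi (n + k) = x1 * q powi k" "a / c * q powi (k - n) = x2 * q powi k"
        "c * q powi (k + l) = x3 * q powi k" "a / b * q powi (k - l) = x4 * q powi k"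
        "c * q * q powi (n + k) = a / x2 * q powi (k + 1)" "a * q / b * q powi (k - n) = a / x1 * q powi (k + 1)"
        "b * q * q powi (k + l) = a / x4 * q powi (k + 1)" "a * q / c * q powi (k - l) = a / x3 * q powi (k + 1)"
        unfolding quotients unfolding x1_def x2_def x3_def x4_def using nz q_nonzero[OF q]
        by (simp_all add: power_int_minus power_int_add power_int_diff field_simps)
      have "f_matrix q a b c n k * g_matrix q a b c k l =
        (poch q (a * q / b) * poch q (b * q / a) * poch q (a * q / c) * poch q (c * q / a)
          * poch q (b * q) * poch q (q / b) * poch q (c * q) * poch q (q / c))
        / ((poch q q)\<^sup>2 * poch q (a * q) * poch q (q / a) * poch q (a * q / (b * c)) * poch q (b * c * q / a)
            * poch q (c * q / b) * poch q (b * q / c))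
        * ((1 - Y) / (1 - b * c / a)) * (1 / (1 - a)) * q powi (- l)
        * (poch q b / poch q (b * q) * (poch q (a / c) / poch q (a * q / c)) * (poch q c / poch q (c * q)) * (poch q (a / b) / poch q (a * q / b)))
        * ?t k"
        unfolding f_matrix_def g_matrix_def qpoch_infs_def split args vwp_term_def poch_ratio_def Y_def
        using q_nonzero[OF q] by (simp add: power_int_diff power_int_minus_divide power2_eq_square mult_ac)
      also have "\<dots> = K * ?t k"
      proof -
        have factor: "theta q y = (1 - y) * poch q (y * q) * poch q (q / y)" for y
          using poch_step[OF q, of y] by (simp add: theta_def)
        then have ratio: "poch q y / poch q (y * q) = 1 - y" if "theta q y \<noteq> 0" for y
          using poch_step[OF q, of y] that by auto
        have t: "theta q (a / b) = (1 - a / b) * poch q (a * q / b) * poch q (b * q / a)"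
          "theta q (a / c) = (1 - a / c) * poch q (a * q / c) * poch q (c * q / a)"
          "theta q (b * c / a) = (1 - b * c / a) * poch q (b * c * q / a) * poch q (a * q / (b * c))"
          "theta q b = (1 - b) * poch q (b * q) * poch q (q / b)"
          "theta q c = (1 - c) * poch q (c * q) * poch q (q / c)"
          "theta q a = (1 - a) * poch q (a * q) * poch q (q / a)"
          "theta_red q (b / c) = poch q (b * q / c) * poch q (c * q / b)"
          by (simp_all add: factor theta_red_def mult.commute)
        have r: "poch q b / poch q (b * q) = 1 - b" "poch q c / poch q (c * q) = 1 - c"
          "poch q (a / c) / poch q (a * q / c) = 1 - a / c" "poch q (a / b) / poch q (a * q / b) = 1 - a / b"
          using theta_nz(2-5)[THEN ratio] by simp_all
        show ?thesis unfolding K_def t r by (simp add: power2_eq_square mult_ac)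
      qed
      finally show ?thesis .
    qed
    have "(\<lambda>k. norm K * norm (?t k)) summable_on UNIV"
      using abs_summable_int_split[OF vwp_summable[OF q reg nz(1) prod]]
      by (rule summable_on_cmult_right)
    moreover have "(\<Sum>\<^sub>\<infinity>k. K * ?t k) = K * (theta q a * theta_red q (b / c) * theta_red q (b * c / a * q powi (n + l))
        * theta_red q (q powi (n - l)) / (theta q x1 * theta q x2 * theta q x3 * theta q x4))"
      using vwp_sum[OF q reg nz(1) prod ne] unfolding pairs by (simp add: infsum_cmult_right')
    moreover have "K * (theta q a * theta_red q (b / c) * theta_red q (b * c / a * q powi (n + l))
        * theta_red q (q powi (n - l)) / (theta q x1 * theta q x2 * theta q x3 * theta q x4)) = (if n = l then 1 else 0)"
    proof (cases "n = l")
      case True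
      have "K * (theta q a * theta_red q (b / c) * theta_red q (b * c / a * q powi (n + l))
          * theta_red q (q powi (n - l)) / (theta q x1 * theta q x2 * theta q x3 * theta q x4))
        = q powi (- n) * (theta q b * theta q (a / b) * theta q c * theta q (a / c) / theta q (b * c / a)) *
          ((1 - Y) * theta_red q Y / (theta q x1 * theta q x4 * theta q x3 * theta q x2))"
        using True theta_nz bc_nz poch_q_nonzero[OF q] by (simp add: K_def theta_red_1 Y_def mult_ac)
      also have "(1 - Y) * theta_red q Y / (theta q x1 * theta q x4 * theta q x3 * theta q x2)
        = q powi n * (theta q (b * c / a) / (theta q b * theta q (a / b) * theta q c * theta q (a / c)))"
        using theta_ratio_shift[OF q nz, of n] True
        unfolding theta_eq[OF q, of Y, symmetric] by (simp add: Y_def x1_def x2_def x3_def x4_def)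
      finally show ?thesis
        using True theta_nz q_nonzero[OF q] by (simp add: power_int_minus)
    next
      case False
      then show ?thesis by (simp add: theta_red_powi[OF q])
    qed
    ultimately show ?thesis unfolding entry by (simp only: norm_mult simp_thms)
  qed
  then show ?thesis by (auto simp: inverse_matrices_def)
qed

end
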